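(* Let $a,b>0$, let $g\in L^2(\mathbb{R})$, and suppose there is a constant $B$ with $G_0(t)\le B$ for almost every $t$. The following are equivalent: (1) The Walnut series converges symmetrically in norm for every $f\in L^2(\mathbb{R})$, i.e. $\lim_{K\to\infty}S_Kf$ exists in the norm of $L^2(\mathbb{R})$ for every $f\in L^2(\mathbb{R})$. (2) For all $f\in L^2(\mathbb{R})$, $$\lim_{K\to\infty}\frac1b\langle S_Kf,f\rangle=\langle Sf,f\rangle .$$ (3) For all $f\in L^2(\mathbb{R})$, $$\sum_{m,n\in\mathbb{Z}}|\langle f,E_{mb}T_{na}g\rangle|^2=\lim_{K\to\infty}\frac1b\sum_{k=-K}^{K}\int_{\mathbb{R}}\overline{f(t)}f(t-k/b)G_k(t)\,dt .$$
   Context: For $c\in\mathbb{R}$ let $T_cf(x)=f(x-c)$ and $E_cf(x)=e^{2\pi i c x}f(x)$. For $k\in\mathbb{Z}$ put $G_k(t)=\sum_{n\in\mathbb{Z}}g(t-na)\overline{g(t-na-k/b)}$; in particular $G_0(t)=\sum_n|g(t-na)|^2$. For $f\in L^2(\mathbb{R})$ and an integer $K\ge 0$, $S_Kf(t)=\sum_{k=-K}^{K}f(t-k/b)G_k(t)$. The Walnut series of $f$ is $\frac1b\sum_{k\in\mathbb{Z}}(T_{k/b}f)G_k$. The operator $S$ is $Sf=\sum_{m,n\in\mathbb{Z}}\langle f,E_{mb}T_{na}g\rangle E_{mb}T_{na}g$; statement (2) is understood to include that, for every $f\in L^2(\mathbb{R})$, this series converges unconditionally in $L^2(\mathbb{R})$,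 so that $Sf$ is defined. In (2) and (3) the limits are understood to exist as finite numbers, and in (3) the left-hand sum is understood to be finite. *)

theory Defs
  imports "HOL-Analysis.Analysis"
begin

text \<open>
  Elements of \<open>L\<^sup>2(\<real>)\<close> are represented by functions rather than by almost-everywhere
  classes; changing them on null sets changes the notions
  below at most on null sets.
\<close>

definition L2 :: "(real \<Rightarrow> complex) set" where
  "L2 = {f. f \<in> borel_measurable lebesgue \<and> integrable lebesgue (\<lambda>t. (cmod (f t))\<^sup>2)}"

definition l2_inner :: "(real \<Rightarrow> complex) \<Rightarrow> (real \<Rightarrow> complex) \<Rightarrow> complex" where
  "l2_inner f h = (LINT t|lebesgue. f t * cnj (h t))"

definition l2_norm :: "(real \<Rightarrow> complex) \<Rightarrow> real" where
  "l2_norm f = sqrt (LINT t|lebesgue. (cmod (f t))\<^sup>2)"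

text \<open>
  Membership in \<^const>\<open>L2\<close> is part of norm convergence, because \<^const>\<open>l2_norm\<close> takes
  the value \<open>0\<close> at functions that are not square integrable.
\<close>

definition l2_tendsto ::
    "('i \<Rightarrow> real \<Rightarrow> complex) \<Rightarrow> (real \<Rightarrow> complex) \<Rightarrow> 'i filter \<Rightarrow> bool" where
  "l2_tendsto u h F \<longleftrightarrow>
     h \<in> L2 \<and> (\<forall>\<^sub>F i in F. u i \<in> L2) \<and> ((\<lambda>i. l2_norm (\<lambda>t. u i t - h t)) \<longlongrightarrow> 0) F"

text \<open>
  Unconditional convergence in norm: as for \<^const>\<open>has_sum\<close>, the net of all finite partial
  sums converges.
\<close>

definition l2_has_sum ::
    "('i \<Rightarrow> real \<Rightarrow> complex) \<Rightarrow> (real \<Rightarrow> complex) \<Rightarrow> bool" where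
  "l2_has_sum u h \<longleftrightarrow> l2_tendsto (\<lambda>A t. \<Sum>i\<in>A. u i t) h (finite_subsets_at_top UNIV)"

definition translation :: "real \<Rightarrow> (real \<Rightarrow> complex) \<Rightarrow> real \<Rightarrow> complex" where
  "translation c f = (\<lambda>x. f (x - c))"

definition modulation :: "real \<Rightarrow> (real \<Rightarrow> complex) \<Rightarrow> real \<Rightarrow> complex" where
  "modulation c f = (\<lambda>x. exp (2 * of_real pi * \<i> * of_real c * of_real x) * f x)"

definition gabor :: "real \<Rightarrow> real \<Rightarrow> (real \<Rightarrow> complex) \<Rightarrow> int \<times> int \<Rightarrow> real \<Rightarrow> complex" where
  "gabor a b g = (\<lambda>(m, n). modulation (of_int m * b) (translation (of_int n * a) g))"

definition walnut_G ::
    "real \<Rightarrow> real \<Rightarrow> (real \<Rightarrow> complex) \<Rightarrow> int \<Rightarrow> real \<Rightarrow> complex" where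
  "walnut_G a b g k t =
     (\<Sum>\<^sub>\<infinity>n::int. g (t - of_int n * a) * cnj (g (t - of_int n * a - of_int k / b)))"

text \<open>
  The function \<open>G\<^sub>0\<close> with values in \<open>[0,\<infinity>]\<close>. It is used to state upper bounds on
  \<open>G\<^sub>0\<close>, since the complex \<^const>\<open>infsum\<close> is \<open>0\<close> where the sum diverges.
\<close>

definition walnut_G0 :: "real \<Rightarrow> (real \<Rightarrow> complex) \<Rightarrow> real \<Rightarrow> ennreal" where
  "walnut_G0 a g t = (\<Sum>\<^sub>\<infinity>n::int. ennreal ((cmod (g (t - of_int n * a)))\<^sup>2))"

lemma walnut_G_0_eq:
  assumes "walnut_G0 a g t < \<infinity>"
  shows "walnut_G a b g 0 t = of_real (enn2real (walnut_G0 a g t))"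
proof -
  define u where "u n = (cmod (g (t - of_int n * a)))\<^sup>2" for n :: int
  have u0: "u n \<ge> 0" for n
    by (simp add: u_def)
  have G0: "walnut_G0 a g t = (\<Sum>\<^sub>\<infinity>n. ennreal (u n))"
    by (simp add: walnut_G0_def u_def)
  have G0_SUP: "(\<Sum>\<^sub>\<infinity>n. ennreal (u n)) = (SUP F\<in>{F. finite F \<and> F \<subseteq> UNIV}. (\<Sum>n\<in>F. ennreal (u n)))"
    by (rule nonneg_infsum_complete) simp
  have "sum u F \<le> enn2real (walnut_G0 a g t)" if "finite F" for F
  proof -
    have "ennreal (sum u F) = (\<Sum>n\<in>F. ennreal (u n))"
      by (simp add: u0)
    also have "\<dots> \<le> walnut_G0 a g t"
      unfolding G0 G0_SUP by (rule SUP_upper) (use that in simp)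
    finally have "enn2real (ennreal (sum u F)) \<le> enn2real (walnut_G0 a g t)"
      using assms by (intro enn2real_mono) auto
    thus ?thesis
      by (simp add: sum_nonneg u0)
  qed
  hence summ: "u summable_on UNIV"
    by (intro nonneg_bdd_above_summable_on bdd_aboveI2) (auto simp: u0)
  have "ennreal (infsum u UNIV) = walnut_G0 a g t"
    using infsum_nonneg_is_SUPREMUM_ennreal[OF summ] unfolding G0 G0_SUP by (simp add: u0)
  hence "infsum u UNIV = enn2real (walnut_G0 a g t)"
    by (metis enn2real_ennreal infsum_nonneg u0)
  moreover have "walnut_G a b g 0 t = (\<Sum>\<^sub>\<infinity>n. of_real (u n))"
    unfolding walnut_G_def u_def complex_norm_square by simp
  moreover have "(\<Sum>\<^sub>\<infinity>n. complex_of_real (u n)) = of_real (infsum u UNIV)"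
    by (rule infsumI) (use summ in \<open>simp add: has_sum_of_real\<close>)
  ultimately show ?thesis
    by simp
qed

definition walnut_partial ::
    "real \<Rightarrow> real \<Rightarrow> (real \<Rightarrow> complex) \<Rightarrow> nat \<Rightarrow> (real \<Rightarrow> complex) \<Rightarrow> real \<Rightarrow> complex" where
  "walnut_partial a b g K f t =
     (\<Sum>k = - int K..int K. translation (of_int k / b) f t * walnut_G a b g k t)"

definition frame_series ::
    "real \<Rightarrow> real \<Rightarrow> (real \<Rightarrow> complex) \<Rightarrow> (real \<Rightarrow> complex) \<Rightarrow> int \<times> int \<Rightarrow> real \<Rightarrow> complex" where
  "frame_series a b g f = (\<lambda>p t. l2_inner f (gabor a b g p) * gabor a b g p t)"

text \<open>
  The sum is unique up to null sets when it exists; the value is arbitrary otherwise.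
\<close>

definition frame_op ::
    "real \<Rightarrow> real \<Rightarrow> (real \<Rightarrow> complex) \<Rightarrow> (real \<Rightarrow> complex) \<Rightarrow> real \<Rightarrow> complex" where
  "frame_op a b g f = (SOME h. l2_has_sum (frame_series a b g f) h)"

end

theory Submission
  imports Defs
begin

text \<open>
  Write \<open>S\<^sub>K\<close> for the symmetric partial sums and call \<open>(T\<^bsub>k/b\<^esub> f) G\<^sub>k\<close> the Walnut terms of \<open>f\<close>.
  The bound on \<open>G\<^sub>0\<close> gives \<open>\<bar>G\<^sub>k\<bar> \<le> B\<close> almost everywhere, so every \<open>S\<^sub>K\<close> is a bounded operator
  on \<open>L\<^sup>2\<close>. The three statements are equivalent because each of them is equivalent to a
  fourth one: the operators \<open>S\<^sub>K\<close> are uniformly bounded.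

  Each statement implies uniform boundedness. Strong convergence does so by the principle of
  uniform boundedness (\<open>L2_uniform_boundedness\<close>). The second statement implies the third because
  pairing the frame series with \<open>f\<close> turns it into \<open>\<Sum> \<bar>\<langle>f, E\<^bsub>mb\<^esub> T\<^bsub>na\<^esub> g\<rangle>\<bar>\<^sup>2\<close>
  (\<open>frame_op_energy\<close>). The third one makes the numbers \<open>\<langle>S\<^sub>K f, f\<rangle>\<close> bounded in \<open>K\<close>; by
  polarization so are the numbers \<open>\<langle>S\<^sub>K f, h\<rangle>\<close>, and uniform boundedness applied first to the functionals
  \<open>h \<mapsto> \<langle>S\<^sub>K f, h\<rangle>\<close> and then to the operators gives the claim
  (\<open>uniformly_bounded_if_weakly_bounded\<close>).

  Uniform boundedness implies strong convergence. By density it suffices to treat \<open>f\<close>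
  supported in one interval of length \<open>1/b\<close>. Its Walnut terms have disjoint supports, hence are
  orthogonal, and \<open>\<parallel>S\<^sub>K f\<parallel>\<^sup>2\<close> is the sum of the squared norms of those with \<open>\<bar>k\<bar> \<le> K\<close>.
  Boundedness of these sums is therefore convergence of the series
  (\<open>partial_converges_if_uniformly_bounded\<close>).

  Uniform boundedness implies the Walnut identity. For compactly supported \<open>f\<close> the identity
  holds without a limit, for all large \<open>K\<close>, by Parseval's identity on a period, applied to the
  \<open>1/b\<close>-periodization of \<open>f \<cdot> cnj (T\<^bsub>na\<^esub> g)\<close>, and summation over \<open>n\<close>
  (\<open>gabor_energy_compact_support\<close>). If \<open>\<parallel>S\<^sub>K\<parallel> \<le> C\<close> for all \<open>K\<close>, this shows that the Gabor system has
  the Bessel bound \<open>C/b\<close> on a dense subspace and so everywhere, both sides of the identity become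
  continuous in \<open>f\<close>, and the identity extends to all of \<open>L\<^sup>2\<close>
  (\<open>walnut_identity_if_uniformly_bounded\<close>). The Bessel bound also gives the unconditional
  convergence of the frame series (\<open>frame_series_converges\<close>).

  The tools from functional and Fourier analysis are developed for \<open>L\<^sup>2(\<real>)\<close> first: completeness,
  uniform boundedness, and Parseval's identity on a period, whose core is the completeness of
  the trigonometric system (\<open>trig_orthogonal_AE_zero\<close>).
\<close>

section \<open>The space \<open>L\<^sup>2\<close>\<close>

lemma L2_measurable: "f \<in> L2 \<Longrightarrow> f \<in> borel_measurable lebesgue"
  by (simp add: L2_def)

lemma L2_integrable: "f \<in> L2 \<Longrightarrow> integrable lebesgue (\<lambda>t. (cmod (f t))\<^sup>2)"
  by (simp add: L2_def)

lemma L2_bound: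
  assumes f: "f \<in> L2" and h: "h \<in> borel_measurable lebesgue"
    and le: "AE t in lebesgue. cmod (h t) \<le> C * cmod (f t)"
  shows "h \<in> L2"
proof -
  have int: "integrable lebesgue (\<lambda>t. C\<^sup>2 * (cmod (f t))\<^sup>2)"
    using L2_integrable[OF f] by simp
  have ae: "AE t in lebesgue. norm ((cmod (h t))\<^sup>2) \<le> norm (C\<^sup>2 * (cmod (f t))\<^sup>2)"
    using le
  proof eventually_elim
    case (elim t)
    then have "(cmod (h t))\<^sup>2 \<le> (C * cmod (f t))\<^sup>2"
      by (intro power_mono) auto
    then show ?case
      by (simp add: power_mult_distrib)
  qed
  have "(\<lambda>t. (cmod (h t))\<^sup>2) \<in> borel_measurable lebesgue"
    using h by measurable
  then have "integrable lebesgue (\<lambda>t. (cmod (h t))\<^sup>2)"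
    by (rule Bochner_Integration.integrable_bound[OF int _ ae])
  then show ?thesis
    using h by (simp add: L2_def)
qed

lemma L2_zero [simp]: "(\<lambda>t. 0) \<in> L2"
  by (simp add: L2_def)

lemma L2_cmult [simp]: "f \<in> L2 \<Longrightarrow> (\<lambda>t. c * f t) \<in> L2"
  by (rule L2_bound[of f _ "cmod c"]) (auto dest: L2_measurable simp: norm_mult)

lemma L2_add [simp]:
  assumes f: "f \<in> L2" and h: "h \<in> L2"
  shows "(\<lambda>t. f t + h t) \<in> L2"
proof -
  have "integrable lebesgue (\<lambda>t. 2 * (cmod (f t))\<^sup>2 + 2 * (cmod (h t))\<^sup>2)"
    using f h by (simp add: L2_integrable)
  moreover have "(cmod (f t + h t))\<^sup>2 \<le> 2 * (cmod (f t))\<^sup>2 + 2 * (cmod (h t))\<^sup>2" for t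
  proof -
    have "(cmod (f t + h t))\<^sup>2 \<le> (cmod (f t) + cmod (h t))\<^sup>2"
      by (intro power_mono norm_triangle_ineq) auto
    also have "\<dots> \<le> 2 * (cmod (f t))\<^sup>2 + 2 * (cmod (h t))\<^sup>2"
      using sum_squares_bound[of "cmod (f t)" "cmod (h t)"] by (simp add: power2_sum)
    finally show ?thesis .
  qed
  moreover have "(\<lambda>t. f t + h t) \<in> borel_measurable lebesgue"
    using L2_measurable f h by measurable
  ultimately show ?thesis
    unfolding L2_def by (auto intro!: Bochner_Integration.integrable_bound[of lebesgue "\<lambda>t. 2 * (cmod (f t))\<^sup>2 + 2 * (cmod (h t))\<^sup>2"])
qed

lemma L2_uminus [simp]: "f \<in> L2 \<Longrightarrow> (\<lambda>t. - f t) \<in> L2"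
  using L2_cmult[of f "-1"] by simp

lemma L2_diff [simp]: "f \<in> L2 \<Longrightarrow> h \<in> L2 \<Longrightarrow> (\<lambda>t. f t - h t) \<in> L2"
  using L2_add[of f "\<lambda>t. - h t"] by simp

lemma L2_sum [simp]: "(\<And>i. i \<in> A \<Longrightarrow> u i \<in> L2) \<Longrightarrow> (\<lambda>t. \<Sum>i\<in>A. u i t) \<in> L2"
  by (induction A rule: infinite_finite_induct) auto

lemma L2_indicator [simp]:
  "f \<in> L2 \<Longrightarrow> A \<in> sets borel \<Longrightarrow> (\<lambda>t. indicator A t * f t) \<in> L2"
  by (rule L2_bound[of f _ 1])
    (auto dest!: L2_measurable intro!: borel_measurable_times borel_measurable_indicator
      simp: norm_mult split: split_indicator)

lemma integrable_L2_mult: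
  assumes f: "f \<in> L2" and h: "h \<in> L2"
  shows "integrable lebesgue (\<lambda>t. f t * h t)"
proof -
  have "integrable lebesgue (\<lambda>t. (cmod (f t))\<^sup>2 + (cmod (h t))\<^sup>2)"
    using f h by (simp add: L2_integrable)
  moreover have "cmod (f t * h t) \<le> (cmod (f t))\<^sup>2 + (cmod (h t))\<^sup>2" for t
    using sum_squares_bound[of "cmod (f t)" "cmod (h t)"]
      mult_nonneg_nonneg[OF norm_ge_zero[of "f t"] norm_ge_zero[of "h t"]]
    unfolding norm_mult by linarith
  moreover have "(\<lambda>t. f t * h t) \<in> borel_measurable lebesgue"
    using L2_measurable f h by measurable
  ultimately show ?thesis
    by (auto intro!: Bochner_Integration.integrable_bound[of lebesgue "\<lambda>t. (cmod (f t))\<^sup>2 + (cmod (h t))\<^sup>2"])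
qed

lemma borel_measurable_cnj [measurable (raw)]:
  "f \<in> borel_measurable M \<Longrightarrow> (\<lambda>x. cnj (f x)) \<in> borel_measurable M"
  by (rule measurable_compose[OF _ borel_measurable_continuous_onI[OF continuous_on_cnj[OF continuous_on_id]]])

lemma L2_cnj [simp]: "f \<in> L2 \<Longrightarrow> (\<lambda>t. cnj (f t)) \<in> L2"
  by (rule L2_bound[of f _ 1]) (auto dest!: L2_measurable)

lemma integrable_L2_inner [simp]:
  "f \<in> L2 \<Longrightarrow> h \<in> L2 \<Longrightarrow> integrable lebesgue (\<lambda>t. f t * cnj (h t))"
  by (rule integrable_L2_mult) auto

lemma l2_inner_add_left [simp]:
  "f \<in> L2 \<Longrightarrow> h \<in> L2 \<Longrightarrow> k \<in> L2 \<Longrightarrow>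
   l2_inner (\<lambda>t. f t + h t) k = l2_inner f k + l2_inner h k"
  by (simp add: l2_inner_def distrib_right)

lemma l2_inner_diff_left [simp]:
  "f \<in> L2 \<Longrightarrow> h \<in> L2 \<Longrightarrow> k \<in> L2 \<Longrightarrow>
   l2_inner (\<lambda>t. f t - h t) k = l2_inner f k - l2_inner h k"
  by (simp add: l2_inner_def left_diff_distrib)

lemma l2_inner_cmult_left [simp]: "l2_inner (\<lambda>t. c * f t) h = c * l2_inner f h"
  by (simp add: l2_inner_def mult.assoc)

lemma l2_inner_commute: "l2_inner f h = cnj (l2_inner h f)"
proof -
  have "cnj (l2_inner h f) = (LINT t|lebesgue. cnj (h t * cnj (f t)))"
    by (simp add: l2_inner_def del: complex_cnj_mult)
  then show ?thesis
    by (simp add: l2_inner_def mult.commute)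
qed

lemma l2_inner_add_right [simp]:
  "f \<in> L2 \<Longrightarrow> h \<in> L2 \<Longrightarrow> k \<in> L2 \<Longrightarrow>
   l2_inner k (\<lambda>t. f t + h t) = l2_inner k f + l2_inner k h"
  using l2_inner_add_left[of f h k] by (metis complex_cnj_add l2_inner_commute)

lemma l2_inner_diff_right [simp]:
  "f \<in> L2 \<Longrightarrow> h \<in> L2 \<Longrightarrow> k \<in> L2 \<Longrightarrow>
   l2_inner k (\<lambda>t. f t - h t) = l2_inner k f - l2_inner k h"
  using l2_inner_diff_left[of f h k] by (metis complex_cnj_diff l2_inner_commute)

lemma l2_inner_cmult_right [simp]: "l2_inner h (\<lambda>t. c * f t) = cnj c * l2_inner h f"
  using l2_inner_cmult_left[of c f h] by (metis complex_cnj_mult l2_inner_commute)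

lemma l2_inner_zero_left [simp]: "l2_inner (\<lambda>t. 0) f = 0"
  by (simp add: l2_inner_def)

lemma l2_inner_zero_right [simp]: "l2_inner f (\<lambda>t. 0) = 0"
  by (simp add: l2_inner_def)

lemma l2_inner_sum_left:
  "(\<And>i. i \<in> A \<Longrightarrow> u i \<in> L2) \<Longrightarrow> h \<in> L2 \<Longrightarrow>
   l2_inner (\<lambda>t. \<Sum>i\<in>A. u i t) h = (\<Sum>i\<in>A. l2_inner (u i) h)"
  by (induction A rule: infinite_finite_induct) auto

lemma l2_inner_sum_right:
  "(\<And>i. i \<in> A \<Longrightarrow> u i \<in> L2) \<Longrightarrow> h \<in> L2 \<Longrightarrow>
   l2_inner h (\<lambda>t. \<Sum>i\<in>A. u i t) = (\<Sum>i\<in>A. l2_inner h (u i))"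
  by (induction A rule: infinite_finite_induct) auto

lemma l2_norm_nonneg [simp]: "l2_norm f \<ge> 0"
  by (simp add: l2_norm_def)

lemma l2_norm_sq: "(l2_norm f)\<^sup>2 = (LINT t|lebesgue. (cmod (f t))\<^sup>2)"
  by (simp add: l2_norm_def)

lemma l2_norm_zero [simp]: "l2_norm (\<lambda>t. 0) = 0"
  by (simp add: l2_norm_def)

lemma l2_inner_self: "l2_inner f f = of_real ((l2_norm f)\<^sup>2)"
  unfolding l2_norm_sq l2_inner_def
  by (simp add: complex_norm_square[symmetric] del: of_real_power)

lemma l2_norm_cmult [simp]: "l2_norm (\<lambda>t. c * f t) = cmod c * l2_norm f"
  by (simp add: l2_norm_def norm_mult power_mult_distrib real_sqrt_mult)

lemma l2_norm_minus_commute: "l2_norm (\<lambda>t. f t - h t) = l2_norm (\<lambda>t. h t - f t)"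
  by (simp add: l2_norm_def norm_minus_commute)

lemma l2_norm_add_sq:
  assumes "f \<in> L2" "h \<in> L2"
  shows "(l2_norm (\<lambda>t. f t + h t))\<^sup>2 = (l2_norm f)\<^sup>2 + 2 * Re (l2_inner f h) + (l2_norm h)\<^sup>2"
proof -
  have "Re (l2_inner h f) = Re (l2_inner f h)"
    by (subst l2_inner_commute) simp
  moreover have "complex_of_real ((l2_norm (\<lambda>t. f t + h t))\<^sup>2) =
      l2_inner f f + l2_inner f h + (l2_inner h f + l2_inner h h)"
    using assms by (simp add: l2_inner_self[symmetric] del: of_real_power)
  then have "Re (complex_of_real ((l2_norm (\<lambda>t. f t + h t))\<^sup>2)) =
      Re (l2_inner f f + l2_inner f h + (l2_inner h f + l2_inner h h))"
    by (rule arg_cong)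
  ultimately show ?thesis
    by (simp add: l2_inner_self del: of_real_power)
qed

lemma l2_norm_uminus [simp]: "l2_norm (\<lambda>t. - f t) = l2_norm f"
  by (simp add: l2_norm_def)

lemma l2_inner_uminus_right [simp]: "l2_inner f (\<lambda>t. - h t) = - l2_inner f h"
  by (simp add: l2_inner_def)

lemma l2_norm_diff_sq:
  assumes "f \<in> L2" "h \<in> L2"
  shows "(l2_norm (\<lambda>t. f t - h t))\<^sup>2 = (l2_norm f)\<^sup>2 - 2 * Re (l2_inner f h) + (l2_norm h)\<^sup>2"
  using l2_norm_add_sq[of f "\<lambda>t. - h t"] assms by simp

text \<open>
  The squared norm of \<open>f - s * \<langle>f, h\<rangle> * h\<close> is a nonnegative quadratic polynomial in the real number \<open>s\<close>.
\<close>

lemma l2_inner_cauchy_schwarz: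
  assumes f: "f \<in> L2" and h: "h \<in> L2"
  shows "cmod (l2_inner f h) \<le> l2_norm f * l2_norm h"
proof -
  define c where "c = l2_inner f h"
  define F where "F = (l2_norm f)\<^sup>2"
  define N where "N = (l2_norm h)\<^sup>2"
  have pos: "0 \<le> F - 2 * s * (cmod c)\<^sup>2 + s\<^sup>2 * (cmod c)\<^sup>2 * N" for s :: real
  proof -
    have "Re (l2_inner f (\<lambda>t. (of_real s * c) * h t)) = s * (cmod c)\<^sup>2"
      by (simp add: c_def[symmetric] cmod_power2 algebra_simps) (simp add: power2_eq_square)
    moreover have "(l2_norm (\<lambda>t. (of_real s * c) * h t))\<^sup>2 = s\<^sup>2 * (cmod c)\<^sup>2 * N"
      by (simp add: norm_mult power_mult_distrib N_def)
    ultimately have "(l2_norm (\<lambda>t. f t - (of_real s * c) * h t))\<^sup>2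
        = F - 2 * s * (cmod c)\<^sup>2 + s\<^sup>2 * (cmod c)\<^sup>2 * N"
      using f h by (subst l2_norm_diff_sq) (auto simp: F_def)
    then show ?thesis
      by (metis zero_le_power2)
  qed
  have "(cmod c)\<^sup>2 \<le> F * N"
  proof (cases "N = 0")
    case True
    \<comment> \<open>The quadratic is then affine in \<open>s\<close>, and negative for large \<open>s\<close> unless \<open>c = 0\<close>.\<close>
    have "(cmod c)\<^sup>2 = 0"
    proof (rule ccontr)
      assume "(cmod c)\<^sup>2 \<noteq> 0"
      with pos[of "(F + 1) / (2 * (cmod c)\<^sup>2)"] True show False
        by simp
    qed
    then show ?thesis using True by simp
  next
    case False
    then have "N > 0" by (simp add: N_def)
    have "0 \<le> F - (cmod c)\<^sup>2 / N"
      using pos[of "1 / N"] False by (simp add: power2_eq_square field_simps)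
    then show ?thesis
      using \<open>N > 0\<close> by (simp add: field_simps)
  qed
  then have "(cmod c)\<^sup>2 \<le> (l2_norm f * l2_norm h)\<^sup>2"
    by (simp add: F_def N_def power_mult_distrib)
  then show ?thesis
    unfolding c_def by (rule power2_le_imp_le) simp
qed

lemma l2_norm_triangle:
  assumes f: "f \<in> L2" and h: "h \<in> L2"
  shows "l2_norm (\<lambda>t. f t + h t) \<le> l2_norm f + l2_norm h"
proof (rule power2_le_imp_le)
  have "Re (l2_inner f h) \<le> l2_norm f * l2_norm h"
    using l2_inner_cauchy_schwarz[OF f h] complex_Re_le_cmod[of "l2_inner f h"] by linarith
  then show "(l2_norm (\<lambda>t. f t + h t))\<^sup>2 \<le> (l2_norm f + l2_norm h)\<^sup>2"
    unfolding l2_norm_add_sq[OF f h] power2_sum by simp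
qed simp

lemma l2_norm_triangle_diff:
  assumes f: "f \<in> L2" and h: "h \<in> L2" and k: "k \<in> L2"
  shows "l2_norm (\<lambda>t. f t - k t) \<le> l2_norm (\<lambda>t. f t - h t) + l2_norm (\<lambda>t. h t - k t)"
  using l2_norm_triangle[of "\<lambda>t. f t - h t" "\<lambda>t. h t - k t"] assms by simp

lemma l2_norm_sum:
  "(\<And>i. i \<in> A \<Longrightarrow> u i \<in> L2) \<Longrightarrow> l2_norm (\<lambda>t. \<Sum>i\<in>A. u i t) \<le> (\<Sum>i\<in>A. l2_norm (u i))"
proof (induction A rule: infinite_finite_induct)
  case (insert x F)
  then have "l2_norm (\<lambda>t. u x t + (\<Sum>i\<in>F. u i t)) \<le> l2_norm (u x) + l2_norm (\<lambda>t. \<Sum>i\<in>F. u i t)"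
    by (intro l2_norm_triangle) auto
  with insert show ?case by fastforce
qed auto

lemma l2_norm_sum_orthogonal:
  assumes u: "\<And>i. i \<in> A \<Longrightarrow> u i \<in> L2"
    and orth: "\<And>i j. i \<in> A \<Longrightarrow> j \<in> A \<Longrightarrow> i \<noteq> j \<Longrightarrow> l2_inner (u i) (u j) = 0"
  shows "(l2_norm (\<lambda>t. \<Sum>i\<in>A. u i t))\<^sup>2 = (\<Sum>i\<in>A. (l2_norm (u i))\<^sup>2)"
  using assms
proof (induction A rule: infinite_finite_induct)
  case (insert x F)
  have "l2_inner (u x) (\<lambda>t. \<Sum>i\<in>F. u i t) = (\<Sum>i\<in>F. l2_inner (u x) (u i))"
    using insert by (intro l2_inner_sum_right) auto
  also have "\<dots> = 0"
    using insert by (intro sum.neutral) auto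
  finally have "(l2_norm (\<lambda>t. u x t + (\<Sum>i\<in>F. u i t)))\<^sup>2
      = (l2_norm (u x))\<^sup>2 + (l2_norm (\<lambda>t. \<Sum>i\<in>F. u i t))\<^sup>2"
    using insert by (subst l2_norm_add_sq) auto
  with insert show ?case by simp
qed auto

lemma l2_norm_mono_AE:
  assumes f: "f \<in> L2" and h: "h \<in> borel_measurable lebesgue" and C: "C \<ge> 0"
    and le: "AE t in lebesgue. cmod (h t) \<le> C * cmod (f t)"
  shows "l2_norm h \<le> C * l2_norm f"
proof (rule power2_le_imp_le)
  have h': "h \<in> L2" using f h le by (rule L2_bound)
  have "(LINT t|lebesgue. (cmod (h t))\<^sup>2) \<le> (LINT t|lebesgue. C\<^sup>2 * (cmod (f t))\<^sup>2)"
  proof (rule integral_mono_AE)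
    show "AE t in lebesgue. (cmod (h t))\<^sup>2 \<le> C\<^sup>2 * (cmod (f t))\<^sup>2"
      using le
    proof eventually_elim
      case (elim t)
      then have "(cmod (h t))\<^sup>2 \<le> (C * cmod (f t))\<^sup>2"
        by (intro power_mono) auto
      then show ?case
        by (simp add: power_mult_distrib)
    qed
  qed (use f h' in \<open>auto simp: L2_integrable\<close>)
  then show "(l2_norm h)\<^sup>2 \<le> (C * l2_norm f)\<^sup>2"
    by (simp add: l2_norm_sq power_mult_distrib)
qed (use C in simp)

lemma l2_norm_sq_nn_integral:
  assumes "f \<in> L2"
  shows "ennreal ((l2_norm f)\<^sup>2) = (\<integral>\<^sup>+t. ennreal ((cmod (f t))\<^sup>2) \<partial>lebesgue)"
  unfolding l2_norm_sq using L2_integrable[OF assms] by (simp add: nn_integral_eq_integral)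

lemma L2_nn_integral_iff:
  assumes "f \<in> borel_measurable lebesgue"
  shows "f \<in> L2 \<longleftrightarrow> (\<integral>\<^sup>+t. ennreal ((cmod (f t))\<^sup>2) \<partial>lebesgue) < \<infinity>"
  using assms by (simp add: L2_def integrable_iff_bounded)

section \<open>Completeness and unconditional convergence\<close>

text \<open>
  Fatou's lemma for the squares of the absolute values. It turns the almost everywhere limit
  of a subsequence into a limit in norm, and shows that this limit is square integrable.
\<close>

lemma l2_fatou:
  assumes v: "\<And>n. v n \<in> L2" and w: "w \<in> borel_measurable lebesgue"
    and lim: "AE t in lebesgue. (\<lambda>n. v n t) \<longlonglongrightarrow> w t"
    and C: "\<forall>\<^sub>F n in sequentially. l2_norm (v n) \<le> C" and "C \<ge> 0"
  shows "w \<in> L2" and "l2_norm w \<le> C"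
proof -
  have vm: "\<And>n. v n \<in> borel_measurable lebesgue"
    using v by (simp add: L2_measurable)
  have "(\<integral>\<^sup>+t. ennreal ((cmod (w t))\<^sup>2) \<partial>lebesgue)
      = (\<integral>\<^sup>+t. liminf (\<lambda>n. ennreal ((cmod (v n t))\<^sup>2)) \<partial>lebesgue)"
  proof (rule nn_integral_cong_AE)
    show "AE t in lebesgue. ennreal ((cmod (w t))\<^sup>2) = liminf (\<lambda>n. ennreal ((cmod (v n t))\<^sup>2))"
      using lim
    proof eventually_elim
      case (elim t)
      then have "(\<lambda>n. ennreal ((cmod (v n t))\<^sup>2)) \<longlonglongrightarrow> ennreal ((cmod (w t))\<^sup>2)"
        by (intro tendsto_intros)
      then show ?case
        by (rule lim_imp_Liminf[OF sequentially_bot, symmetric])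
    qed
  qed
  also have "\<dots> \<le> liminf (\<lambda>n. \<integral>\<^sup>+t. ennreal ((cmod (v n t))\<^sup>2) \<partial>lebesgue)"
    using vm by (intro nn_integral_liminf) measurable
  also have "\<dots> = liminf (\<lambda>n. ennreal ((l2_norm (v n))\<^sup>2))"
    using v by (simp add: l2_norm_sq_nn_integral)
  also have "\<dots> \<le> liminf (\<lambda>n. ennreal (C\<^sup>2))"
    using C by (intro Liminf_mono eventually_mono[OF C]) (auto intro!: ennreal_leI power_mono)
  also have "\<dots> = ennreal (C\<^sup>2)"
    by (simp add: Liminf_const)
  finally have le: "(\<integral>\<^sup>+t. ennreal ((cmod (w t))\<^sup>2) \<partial>lebesgue) \<le> ennreal (C\<^sup>2)" .
  then show w2: "w \<in> L2"
    unfolding L2_nn_integral_iff[OF w] by (rule le_less_trans) simp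
  have "ennreal ((l2_norm w)\<^sup>2) \<le> ennreal (C\<^sup>2)"
    using le l2_norm_sq_nn_integral[OF w2] by simp
  then have "(l2_norm w)\<^sup>2 \<le> C\<^sup>2"
    by (simp add: ennreal_le_iff)
  then show "l2_norm w \<le> C"
    using \<open>C \<ge> 0\<close> by (rule power2_le_imp_le)
qed

text \<open>
  The weights \<open>2 ^ n\<close> on the squared increments are small enough for the weighted series to be
  integrable, hence finite almost everywhere, and large enough to dominate the increments:
  \<open>x \<le> 2 ^ n * x\<^sup>2 + 2 ^ - n\<close>. So the increments are absolutely summable almost everywhere.
\<close>

lemma L2_fast_Cauchy_AE_convergent:
  assumes v: "\<And>n. v n \<in> L2"
    and fast: "\<And>n. l2_norm (\<lambda>t. v (Suc n) t - v n t) \<le> (1 / 2) ^ n"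
  shows "AE t in lebesgue. convergent (\<lambda>n. v n t)"
proof -
  define d where "d n t = v (Suc n) t - v n t" for n t
  have d: "d n \<in> L2" for n
    unfolding d_def using v by simp
  have dm: "d n \<in> borel_measurable lebesgue" for n
    using d by (rule L2_measurable)
  have "(\<integral>\<^sup>+t. (\<Sum>n. ennreal (2 ^ n * (cmod (d n t))\<^sup>2)) \<partial>lebesgue)
      = (\<Sum>n. \<integral>\<^sup>+t. ennreal (2 ^ n * (cmod (d n t))\<^sup>2) \<partial>lebesgue)"
    using dm by (intro nn_integral_suminf) measurable
  also have "\<dots> = (\<Sum>n. ennreal (2 ^ n) * ennreal ((l2_norm (d n))\<^sup>2))"
  proof (rule suminf_cong)
    fix n
    show "(\<integral>\<^sup>+t. ennreal (2 ^ n * (cmod (d n t))\<^sup>2) \<partial>lebesgue) = ennreal (2 ^ n) * ennreal ((l2_norm (d n))\<^sup>2)"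
      unfolding l2_norm_sq_nn_integral[OF d] using dm
      by (subst nn_integral_cmult[symmetric]) (auto simp: ennreal_mult)
  qed
  also have "\<dots> \<le> (\<Sum>n. ennreal ((1 / 2) ^ n))"
  proof (intro suminf_le summableI)
    fix n
    have "(l2_norm (d n))\<^sup>2 \<le> ((1 / 2) ^ n)\<^sup>2"
      using fast[of n] unfolding d_def by (intro power_mono) auto
    then have "2 ^ n * (l2_norm (d n))\<^sup>2 \<le> 2 ^ n * ((1 / 2) ^ n)\<^sup>2"
      by (intro mult_left_mono) auto
    also have "\<dots> = (1 / 2) ^ n"
      by (simp add: power2_eq_square power_divide)
    finally show "ennreal (2 ^ n) * ennreal ((l2_norm (d n))\<^sup>2) \<le> ennreal ((1 / 2) ^ n)"
      by (simp add: ennreal_mult[symmetric] ennreal_leI)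
  qed
  also have "\<dots> = ennreal (\<Sum>n. (1 / 2) ^ n)"
    by (rule suminf_ennreal2) (auto intro: summable_geometric)
  also have "\<dots> < \<infinity>" by simp
  finally have "AE t in lebesgue. (\<Sum>n. ennreal (2 ^ n * (cmod (d n t))\<^sup>2)) \<noteq> \<infinity>"
    using dm by (intro nn_integral_PInf_AE) auto
  then show ?thesis
  proof eventually_elim
    case (elim t)
    then have s: "summable (\<lambda>n. 2 ^ n * (cmod (d n t))\<^sup>2)"
      by (intro summable_suminf_not_top) auto
    have "summable (\<lambda>n. 2 ^ n * (cmod (d n t))\<^sup>2 + (1 / 2) ^ n)"
      using s by (intro summable_add summable_geometric) auto
    moreover have "norm (d n t) \<le> 2 ^ n * (cmod (d n t))\<^sup>2 + (1 / 2) ^ n" for n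
    proof -
      define x y where "x = cmod (d n t)" and "y = (2 :: real) ^ n"
      have "y > 0" by (simp add: y_def)
      have "y * x \<ge> 0"
        using \<open>y > 0\<close> by (simp add: x_def)
      then have "y * x \<le> (y * x)\<^sup>2 + 1"
        using sum_squares_bound[of "y * x" 1] by simp
      then have "x \<le> y * x\<^sup>2 + 1 / y"
        using \<open>y > 0\<close> by (simp add: field_simps power2_eq_square)
      then show ?thesis
        by (simp add: x_def y_def power_divide)
    qed
    ultimately have "summable (\<lambda>n. d n t)"
      by (rule summable_comparison_test'[where N = 0])
    then have "convergent (\<lambda>N. \<Sum>n<N. d n t)"
      by (simp add: summable_iff_convergent)
    moreover have "(\<Sum>n<N. d n t) = v N t - v 0 t" for N
      unfolding d_def by (rule sum_lessThan_telescope)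
    ultimately have "convergent (\<lambda>N. v N t - v 0 t)"
      by simp
    then have "convergent (\<lambda>N. (v N t - v 0 t) + v 0 t)"
      by (intro convergent_add convergent_const)
    then show ?case by simp
  qed
qed

text \<open>
  The Riesz-Fischer theorem. A fast subsequence converges almost everywhere, and Fatou's lemma
  passes the Cauchy estimate to its pointwise limit.
\<close>

theorem L2_complete:
  assumes u: "\<And>n::nat. u n \<in> L2"
    and Cauchy: "\<And>e. e > 0 \<Longrightarrow> \<exists>M. \<forall>m\<ge>M. \<forall>n\<ge>M. l2_norm (\<lambda>t. u m t - u n t) \<le> e"
  obtains h where "h \<in> L2" "(\<lambda>n. l2_norm (\<lambda>t. u n t - h t)) \<longlonglongrightarrow> 0"
proof -
  have "\<forall>k. \<exists>M. \<forall>m\<ge>M. \<forall>n\<ge>M. l2_norm (\<lambda>t. u m t - u n t) \<le> (1 / 2) ^ k"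
    by (intro allI Cauchy) simp
  then obtain M where M: "\<And>k m n. M k \<le> m \<Longrightarrow> M k \<le> n \<Longrightarrow> l2_norm (\<lambda>t. u m t - u n t) \<le> (1 / 2) ^ k"
    by metis
  define r where "r k = (\<Sum>j\<le>k. M j) + k" for k
  have rM: "M k \<le> r k" for k
    unfolding r_def by (simp add: member_le_sum trans_le_add1)
  have r_Suc: "r k \<le> r (Suc k)" for k
    by (simp add: r_def)
  have r_ge: "k \<le> r k" for k
    by (simp add: r_def)
  have conv: "AE t in lebesgue. convergent (\<lambda>k. u (r k) t)"
    by (intro L2_fast_Cauchy_AE_convergent u M rM order_trans[OF rM r_Suc])
  define h where "h t = lim (\<lambda>k. u (r k) t)" for t
  have lim: "AE t in lebesgue. (\<lambda>k. u (r k) t) \<longlonglongrightarrow> h t"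
    using conv by eventually_elim (simp add: h_def convergent_LIMSEQ_iff)
  have um: "u n \<in> borel_measurable lebesgue" for n
    using u by (rule L2_measurable)
  have hm: "h \<in> borel_measurable lebesgue"
    unfolding h_def using um by measurable
  have close: "(\<lambda>t. u m t - h t) \<in> L2 \<and> l2_norm (\<lambda>t. u m t - h t) \<le> e"
    if "e > 0" and N: "\<forall>m\<ge>N. \<forall>n\<ge>N. l2_norm (\<lambda>t. u m t - u n t) \<le> e" and "m \<ge> N" for e N m
  proof -
    have 1: "AE t in lebesgue. (\<lambda>k. u m t - u (r k) t) \<longlonglongrightarrow> u m t - h t"
      using lim by eventually_elim (intro tendsto_intros)
    have 2: "\<forall>\<^sub>F k in sequentially. l2_norm (\<lambda>t. u m t - u (r k) t) \<le> e"
      using eventually_ge_at_top[of N]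
    proof eventually_elim
      case (elim k)
      then show ?case using N \<open>m \<ge> N\<close> r_ge[of k] by auto
    qed
    have "(\<lambda>t. u m t - h t) \<in> borel_measurable lebesgue"
      using um hm by measurable
    then show ?thesis
      using l2_fatou[OF _ _ 1 2] u \<open>e > 0\<close> by simp
  qed
  show thesis
  proof
    obtain N where N: "\<forall>m\<ge>N. \<forall>n\<ge>N. l2_norm (\<lambda>t. u m t - u n t) \<le> 1"
      using Cauchy[of 1] by auto
    have "(\<lambda>t. u N t - h t) \<in> L2"
      using close[OF _ N, of N] by simp
    then have "(\<lambda>t. u N t - (u N t - h t)) \<in> L2"
      by (rule L2_diff[OF u])
    moreover have "(\<lambda>t. u N t - (u N t - h t)) = h"
      by auto
    ultimately show "h \<in> L2" by metis
    show "(\<lambda>n. l2_norm (\<lambda>t. u n t - h t)) \<longlonglongrightarrow> 0"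
    proof (rule LIMSEQ_I)
      fix e :: real assume "e > 0"
      then obtain N where N: "\<forall>m\<ge>N. \<forall>n\<ge>N. l2_norm (\<lambda>t. u m t - u n t) \<le> e / 2"
        using Cauchy[of "e / 2"] by auto
      have "l2_norm (\<lambda>t. u m t - h t) < e" if "m \<ge> N" for m
        using close[OF _ N that] \<open>e > 0\<close> by fastforce
      then show "\<exists>N. \<forall>n\<ge>N. norm (l2_norm (\<lambda>t. u n t - h t) - 0) < e"
        by auto
    qed
  qed
qed

lemma l2_tendsto_add:
  assumes "l2_tendsto u h F" "l2_tendsto v k F"
  shows "l2_tendsto (\<lambda>i t. u i t + v i t) (\<lambda>t. h t + k t) F"
proof -
  have h: "h \<in> L2" and k: "k \<in> L2"
    and u2: "\<forall>\<^sub>F i in F. u i \<in> L2" and v2: "\<forall>\<^sub>F i in F. v i \<in> L2"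
    and uh: "((\<lambda>i. l2_norm (\<lambda>t. u i t - h t)) \<longlongrightarrow> 0) F"
    and vk: "((\<lambda>i. l2_norm (\<lambda>t. v i t - k t)) \<longlongrightarrow> 0) F"
    using assms by (auto simp: l2_tendsto_def)
  have "\<forall>\<^sub>F i in F. norm (l2_norm (\<lambda>t. (u i t + v i t) - (h t + k t)))
      \<le> l2_norm (\<lambda>t. u i t - h t) + l2_norm (\<lambda>t. v i t - k t)"
    using u2 v2
  proof eventually_elim
    case (elim i)
    then show ?case
      using l2_norm_triangle[of "\<lambda>t. u i t - h t" "\<lambda>t. v i t - k t"] h k
      by (simp add: add_diff_add)
  qed
  then have "((\<lambda>i. l2_norm (\<lambda>t. (u i t + v i t) - (h t + k t))) \<longlongrightarrow> 0) F"
    by (rule Lim_null_comparison) (use tendsto_add[OF uh vk] in simp)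
  moreover have "\<forall>\<^sub>F i in F. (\<lambda>t. u i t + v i t) \<in> L2"
    using u2 v2 by eventually_elim simp
  ultimately show ?thesis
    using h k by (simp add: l2_tendsto_def)
qed

lemma tendsto_l2_inner:
  assumes u: "l2_tendsto u h F" and v: "l2_tendsto v k F"
  shows "((\<lambda>i. l2_inner (u i) (v i)) \<longlongrightarrow> l2_inner h k) F"
proof -
  have h: "h \<in> L2" and k: "k \<in> L2"
    and u2: "\<forall>\<^sub>F i in F. u i \<in> L2" and v2: "\<forall>\<^sub>F i in F. v i \<in> L2"
    and uh: "((\<lambda>i. l2_norm (\<lambda>t. u i t - h t)) \<longlongrightarrow> 0) F"
    and vk: "((\<lambda>i. l2_norm (\<lambda>t. v i t - k t)) \<longlongrightarrow> 0) F"
    using u v by (auto simp: l2_tendsto_def)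
  have "((\<lambda>i. l2_norm (\<lambda>t. u i t - h t) * (l2_norm k + l2_norm (\<lambda>t. v i t - k t))
       + l2_norm h * l2_norm (\<lambda>t. v i t - k t)) \<longlongrightarrow> 0 * (l2_norm k + 0) + l2_norm h * 0) F"
    by (intro tendsto_intros uh vk)
  then have lim: "((\<lambda>i. l2_norm (\<lambda>t. u i t - h t) * (l2_norm k + l2_norm (\<lambda>t. v i t - k t))
       + l2_norm h * l2_norm (\<lambda>t. v i t - k t)) \<longlongrightarrow> 0) F" by simp
  have "\<forall>\<^sub>F i in F. norm (l2_inner (u i) (v i) - l2_inner h k)
      \<le> l2_norm (\<lambda>t. u i t - h t) * (l2_norm k + l2_norm (\<lambda>t. v i t - k t))
       + l2_norm h * l2_norm (\<lambda>t. v i t - k t)"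
    using u2 v2
  proof eventually_elim
    case (elim i)
    have "l2_inner (u i) (v i) - l2_inner h k
        = l2_inner (\<lambda>t. u i t - h t) (v i) + l2_inner h (\<lambda>t. v i t - k t)"
      using h k elim by simp
    also have "cmod \<dots> \<le> l2_norm (\<lambda>t. u i t - h t) * l2_norm (v i)
        + l2_norm h * l2_norm (\<lambda>t. v i t - k t)"
      using h k elim by (intro order_trans[OF norm_triangle_ineq] add_mono l2_inner_cauchy_schwarz) auto
    also have "l2_norm (v i) \<le> l2_norm k + l2_norm (\<lambda>t. v i t - k t)"
      using l2_norm_triangle[of k "\<lambda>t. v i t - k t"] k elim by simp
    finally show ?case
      by (simp add: mult_left_mono)
  qed
  then have "((\<lambda>i. l2_inner (u i) (v i) - l2_inner h k) \<longlongrightarrow> 0) F"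
    by (rule Lim_null_comparison[OF _ lim])
  then show ?thesis
    by (simp add: Lim_null[symmetric])
qed

lemma l2_tendsto_const: "h \<in> L2 \<Longrightarrow> l2_tendsto (\<lambda>_. h) h F"
  by (simp add: l2_tendsto_def)

lemma has_sum_l2_inner:
  assumes u: "\<And>i. u i \<in> L2" and h: "l2_has_sum u h" and v: "v \<in> L2"
  shows "((\<lambda>i. l2_inner (u i) v) has_sum l2_inner h v) UNIV"
  using tendsto_l2_inner[OF h[unfolded l2_has_sum_def] l2_tendsto_const[OF v]] u v
  by (simp add: has_sum_def l2_inner_sum_left)

text \<open>
  A criterion that covers both kinds of series that occur below: orthogonal series, with \<open>C = 1\<close>
  and \<open>w\<close> the squared norms of the terms, and frame series, with \<open>w\<close> the squared coefficients and
  \<open>C\<close> the Bessel bound. The partial sums form a Cauchy net because a finite sum over indices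
  outside a large finite set is small; a sequence of such large sets yields the limit.
\<close>

lemma l2_has_sum_exists:
  fixes u :: "'i \<Rightarrow> real \<Rightarrow> complex" and w :: "'i \<Rightarrow> real"
  assumes u: "\<And>i. u i \<in> L2"
    and bound: "\<And>A. finite A \<Longrightarrow> (l2_norm (\<lambda>t. \<Sum>i\<in>A. u i t))\<^sup>2 \<le> C * sum w A"
    and w: "w summable_on UNIV" and C: "C > 0"
  obtains h where "l2_has_sum u h"
proof -
  let ?S = "\<lambda>A t. \<Sum>i\<in>A. u i t"
  have S: "?S A \<in> L2" for A
    using u by simp
  have tail: "\<exists>X. finite X \<and> (\<forall>A. finite A \<and> A \<inter> X = {} \<longrightarrow> l2_norm (?S A) \<le> e)" if "e > 0" for e
  proof -
    define \<delta> where "\<delta> = e\<^sup>2 / (2 * C)"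
    have "\<delta> > 0" using that C by (simp add: \<delta>_def)
    have "(sum w \<longlongrightarrow> infsum w UNIV) (finite_subsets_at_top UNIV)"
      using w has_sum_infsum by (simp add: has_sum_def)
    then have "\<forall>\<^sub>F Y in finite_subsets_at_top UNIV. dist (sum w Y) (infsum w UNIV) < \<delta>"
      using \<open>\<delta> > 0\<close> by (rule tendstoD)
    then obtain X where X: "finite X" and close:
      "\<And>Y. finite Y \<Longrightarrow> X \<subseteq> Y \<Longrightarrow> dist (sum w Y) (infsum w UNIV) < \<delta>"
      by (auto simp: eventually_finite_subsets_at_top)
    have "l2_norm (?S A) \<le> e" if A: "finite A" "A \<inter> X = {}" for A
    proof -
      have "sum w (A \<union> X) = sum w A + sum w X"
        using A X by (intro sum.union_disjoint) auto
      then have "sum w A \<le> 2 * \<delta>"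
        using close[of "A \<union> X"] close[of X] A X by (auto simp: dist_real_def abs_if split: if_splits)
      then have "C * sum w A \<le> C * (2 * \<delta>)"
        using C by simp
      also have "\<dots> = e\<^sup>2"
        using C by (simp add: \<delta>_def)
      finally have "(l2_norm (?S A))\<^sup>2 \<le> e\<^sup>2"
        using bound[OF A(1)] by linarith
      then show ?thesis
        using \<open>e > 0\<close> by (auto intro: power2_le_imp_le[OF _ less_imp_le])
    qed
    then show ?thesis using X by blast
  qed
  have close: "l2_norm (\<lambda>t. ?S A t - ?S B t) \<le> 2 * e"
    if X: "\<forall>A. finite A \<and> A \<inter> X = {} \<longrightarrow> l2_norm (?S A) \<le> e"
      and A: "finite A" "X \<subseteq> A" and B: "finite B" "X \<subseteq> B" for X A B e
  proof -
    have "?S A t - ?S B t = ?S (A - B) t - ?S (B - A) t" for t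
      using sum.Int_Diff[OF A(1), of "\<lambda>i. u i t" B] sum.Int_Diff[OF B(1), of "\<lambda>i. u i t" A]
      by (simp add: Int_commute)
    moreover have "l2_norm (\<lambda>t. ?S (A - B) t - ?S (B - A) t) \<le> l2_norm (?S (A - B)) + l2_norm (?S (B - A))"
      using l2_norm_triangle_diff[OF S[of "A - B"] L2_zero S[of "B - A"]] by simp
    moreover have "l2_norm (?S (A - B)) \<le> e" "l2_norm (?S (B - A)) \<le> e"
      using X A B by auto
    ultimately show ?thesis by simp
  qed
  have "\<forall>k::nat. \<exists>X. finite X \<and> (\<forall>A. finite A \<and> A \<inter> X = {} \<longrightarrow> l2_norm (?S A) \<le> inverse (real (Suc k)))"
    by (intro allI tail) simp
  then obtain X where X: "\<And>k. finite (X k)"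
      "\<And>k. \<forall>A. finite A \<and> A \<inter> X k = {} \<longrightarrow> l2_norm (?S A) \<le> inverse (real (Suc k))"
    by metis
  define Y where "Y k = (\<Union>j\<le>k. X j)" for k
  have Y: "finite (Y k)" "j \<le> k \<Longrightarrow> X j \<subseteq> Y k" for j k
    using X by (auto simp: Y_def)
  have small: "\<exists>k. 2 * inverse (real (Suc k)) \<le> e" if "e > 0" for e
  proof -
    obtain k where "inverse (real (Suc k)) < e / 2"
      using reals_Archimedean[of "e / 2"] \<open>e > 0\<close> by auto
    then have "2 * inverse (real (Suc k)) \<le> e" by linarith
    then show ?thesis by blast
  qed
  obtain h where h: "h \<in> L2" "(\<lambda>n. l2_norm (\<lambda>t. ?S (Y n) t - h t)) \<longlonglongrightarrow> 0"
  proof (rule L2_complete[of "\<lambda>n. ?S (Y n)"])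
    fix e :: real assume "e > 0"
    then obtain k where k: "2 * inverse (real (Suc k)) \<le> e" using small by blast
    then have "\<forall>m\<ge>k. \<forall>n\<ge>k. l2_norm (\<lambda>t. ?S (Y m) t - ?S (Y n) t) \<le> e"
      using close[OF X(2)] Y by (meson order_trans)
    then show "\<exists>M. \<forall>m\<ge>M. \<forall>n\<ge>M. l2_norm (\<lambda>t. ?S (Y m) t - ?S (Y n) t) \<le> e" by blast
  qed (use S in auto)
  have "((\<lambda>A. l2_norm (\<lambda>t. ?S A t - h t)) \<longlongrightarrow> 0) (finite_subsets_at_top UNIV)"
  proof (rule tendstoI)
    fix e :: real assume "e > 0"
    then obtain k where k: "2 * inverse (real (Suc k)) \<le> e / 2"
      using small[of "e / 2"] by auto
    have "\<forall>\<^sub>F n in sequentially. l2_norm (\<lambda>t. ?S (Y n) t - h t) < e / 2"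
      using order_tendstoD(2)[OF h(2), of "e / 2"] \<open>e > 0\<close> by simp
    then have "\<forall>\<^sub>F n in sequentially. l2_norm (\<lambda>t. ?S (Y n) t - h t) < e / 2 \<and> n \<ge> k"
      using eventually_ge_at_top[of k] by eventually_elim auto
    then obtain n where n: "l2_norm (\<lambda>t. ?S (Y n) t - h t) < e / 2" "n \<ge> k"
      using eventually_happens'[OF sequentially_bot] by blast
    have "dist (l2_norm (\<lambda>t. ?S A t - h t)) 0 < e" if A: "finite A" "X k \<subseteq> A" for A
    proof -
      have "l2_norm (\<lambda>t. ?S A t - h t) \<le> l2_norm (\<lambda>t. ?S A t - ?S (Y n) t) + l2_norm (\<lambda>t. ?S (Y n) t - h t)"
        by (intro l2_norm_triangle_diff S h(1))
      also have "l2_norm (\<lambda>t. ?S A t - ?S (Y n) t) \<le> e / 2"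
        using close[OF X(2) A Y(1) Y(2)[OF n(2)]] k by linarith
      finally show ?thesis using n by simp
    qed
    then show "\<forall>\<^sub>F A in finite_subsets_at_top UNIV. dist (l2_norm (\<lambda>t. ?S A t - h t)) 0 < e"
      unfolding eventually_finite_subsets_at_top using X(1) by blast
  qed
  then have "l2_has_sum u h"
    unfolding l2_has_sum_def l2_tendsto_def using h(1) S by simp
  then show thesis by (rule that)
qed

section \<open>Uniform boundedness\<close>

text \<open>
  The uniform boundedness principle, for families of seminorms so that it applies to
  \<open>f \<mapsto> \<parallel>S\<^sub>K f\<parallel>\<close> as well as to \<open>h \<mapsto> \<bar>\<langle>S\<^sub>K f, h\<rangle>\<bar>\<close>. The proof is the gliding hump argument without
  Baire's theorem: if the seminorms \<open>q (i n)\<close> have operator norms \<open>N (i n) > 4 ^ n\<close>, a series with steps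
  of size at most \<open>3 ^ - n\<close> is built whose limit \<open>h\<close> satisfies \<open>q (i n) h \<ge> (4 / 3) ^ n / 6\<close>.
\<close>

theorem L2_uniform_boundedness:
  fixes q :: "'i \<Rightarrow> (real \<Rightarrow> complex) \<Rightarrow> real"
  assumes q_add: "\<And>i f h. f \<in> L2 \<Longrightarrow> h \<in> L2 \<Longrightarrow> q i (\<lambda>t. f t + h t) \<le> q i f + q i h"
    and q_scale: "\<And>i c f. f \<in> L2 \<Longrightarrow> q i (\<lambda>t. c * f t) = cmod c * q i f"
    and q_bounded: "\<And>i. \<exists>C. \<forall>f\<in>L2. q i f \<le> C * l2_norm f"
    and pointwise: "\<And>f. f \<in> L2 \<Longrightarrow> \<exists>M. \<forall>i. q i f \<le> M"
  obtains C where "C > 0" "\<And>i f. f \<in> L2 \<Longrightarrow> q i f \<le> C * l2_norm f"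
proof -
  define U where "U = {f \<in> L2. l2_norm f \<le> 1}"
  define N where "N i = (SUP f\<in>U. q i f)" for i
  have U0: "(\<lambda>t. 0) \<in> U"
    by (simp add: U_def)
  have bdd: "bdd_above (q i ` U)" for i
  proof -
    obtain C where C: "\<forall>f\<in>L2. q i f \<le> C * l2_norm f"
      using q_bounded by blast
    have "q i f \<le> \<bar>C\<bar>" if "f \<in> U" for f
    proof -
      have "q i f \<le> C * l2_norm f" using C that by (auto simp: U_def)
      also have "\<dots> \<le> \<bar>C\<bar> * 1"
        using that by (intro mult_mono) (auto simp: U_def)
      finally show ?thesis by simp
    qed
    then show ?thesis by (rule bdd_aboveI2)
  qed
  have q_le_N: "q i f \<le> N i * l2_norm f" if f: "f \<in> L2" for i f
  proof (cases "l2_norm f = 0")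
    case True
    then show ?thesis using q_bounded[of i] f by auto
  next
    case False
    then have pos: "l2_norm f > 0" by (simp add: less_le)
    have "(\<lambda>t. complex_of_real (1 / l2_norm f) * f t) \<in> U"
      using f pos by (simp add: U_def norm_divide del: of_real_divide)
    then have "q i (\<lambda>t. complex_of_real (1 / l2_norm f) * f t) \<le> N i"
      unfolding N_def by (intro cSUP_upper bdd)
    then have "1 / l2_norm f * q i f \<le> N i"
      using pos by (simp add: q_scale[OF f] del: of_real_divide)
    then show ?thesis
      using pos by (simp add: field_simps)
  qed
  have "\<exists>C. \<forall>i. N i \<le> C"
  proof (rule ccontr)
    assume "\<not> (\<exists>C. \<forall>i. N i \<le> C)"
    then have "\<forall>n::nat. \<exists>i. N i > 4 ^ n"
      by (meson not_le)
    then obtain i where i: "\<And>n. N (i n) > 4 ^ n" by metis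
    have N_pos: "N (i n) > 0" for n
      using i[of n] by (rule less_trans[rotated]) simp
    have "\<forall>n. \<exists>f\<in>U. 2 / 3 * N (i n) < q (i n) f"
    proof
      fix n
      have "2 / 3 * N (i n) < N (i n)" using N_pos[of n] by simp
      then show "\<exists>f\<in>U. 2 / 3 * N (i n) < q (i n) f"
        using less_cSUP_iff[OF _ bdd[of "i n"]] U0 unfolding N_def by blast
    qed
    then obtain x where x: "\<And>n. x n \<in> U" "\<And>n. 2 / 3 * N (i n) < q (i n) (x n)"
      by metis
    have xL2: "x n \<in> L2" for n
      using x(1) by (simp add: U_def)
    \<comment> \<open>By the triangle inequality \<open>2 * q z \<le> q (y + z) + q (y - z)\<close>, one of the two signs keeps the value large.\<close>
    have step: "\<exists>y'. y' \<in> L2 \<and> l2_norm (\<lambda>t. y' t - y t) \<le> (1 / 3) ^ n \<and>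
        (1 / 3) ^ n * (2 / 3 * N (i n)) \<le> q (i n) y'" if y: "y \<in> L2" for y n
    proof -
      define z where "z t = complex_of_real ((1 / 3) ^ n) * x n t" for t
      have z: "z \<in> L2" using xL2 by (simp add: z_def[abs_def])
      have "q (i n) z = (1 / 3) ^ n * q (i n) (x n)"
        unfolding z_def using q_scale[OF xL2] by (simp del: of_real_power of_real_divide)
      moreover have "(1 / 3) ^ n * (2 / 3 * N (i n)) \<le> (1 / 3) ^ n * q (i n) (x n)"
        using x(2)[of n] by (intro mult_left_mono) auto
      ultimately have qz: "(1 / 3) ^ n * (2 / 3 * N (i n)) \<le> q (i n) z" by simp
      have nz: "l2_norm z \<le> (1 / 3) ^ n"
        using x(1)[of n] unfolding z_def[abs_def]
        by (simp add: U_def mult_left_le norm_power norm_divide)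
      have "2 * q (i n) z = q (i n) (\<lambda>t. 2 * z t)"
        using q_scale[OF z, of "i n" 2] by simp
      also have "(\<lambda>t. 2 * z t) = (\<lambda>t. (y t + z t) + (-1) * (y t - z t))"
        by (auto simp: algebra_simps)
      also have "q (i n) \<dots> \<le> q (i n) (\<lambda>t. y t + z t) + q (i n) (\<lambda>t. (-1) * (y t - z t))"
        using y z by (intro q_add) auto
      also have "q (i n) (\<lambda>t. (-1) * (y t - z t)) = q (i n) (\<lambda>t. y t - z t)"
        using y z by (subst q_scale) auto
      finally have "q (i n) z \<le> q (i n) (\<lambda>t. y t + z t) \<or> q (i n) z \<le> q (i n) (\<lambda>t. y t - z t)"
        by linarith
      then show ?thesis
      proof
        assume "q (i n) z \<le> q (i n) (\<lambda>t. y t + z t)"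
        then show ?thesis using y z nz qz by (intro exI[of _ "\<lambda>t. y t + z t"]) auto
      next
        assume "q (i n) z \<le> q (i n) (\<lambda>t. y t - z t)"
        then show ?thesis using y z nz qz by (intro exI[of _ "\<lambda>t. y t - z t"]) auto
      qed
    qed
    have "\<exists>y. \<forall>n. y n \<in> L2 \<and> (l2_norm (\<lambda>t. y (Suc n) t - y n t) \<le> (1 / 3) ^ n \<and>
        (1 / 3) ^ n * (2 / 3 * N (i n)) \<le> q (i n) (y (Suc n)))"
      by (rule dependent_nat_choice) (use step L2_zero in blast)+
    then obtain y where y: "\<And>n. y n \<in> L2"
        and y_step: "\<And>n. l2_norm (\<lambda>t. y (Suc n) t - y n t) \<le> (1 / 3) ^ n"
        and qy: "\<And>n. (1 / 3) ^ n * (2 / 3 * N (i n)) \<le> q (i n) (y (Suc n))"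
      by blast
    have dist: "l2_norm (\<lambda>t. y (m + k) t - y m t) \<le> 3 / 2 * ((1 / 3) ^ m - (1 / 3) ^ (m + k))" for m k
    proof (induction k)
      case (Suc k)
      have "l2_norm (\<lambda>t. y (m + Suc k) t - y m t)
          \<le> l2_norm (\<lambda>t. y (Suc (m + k)) t - y (m + k) t) + l2_norm (\<lambda>t. y (m + k) t - y m t)"
        using y by (simp add: l2_norm_triangle_diff)
      moreover have "(1 / 3 :: real) ^ (m + Suc k) = (1 / 3) ^ (m + k) / 3" by simp
      ultimately show ?case
        using Suc y_step[of "m + k"] unfolding right_diff_distrib by linarith
    qed simp
    have dist': "l2_norm (\<lambda>t. y n t - y m t) \<le> 3 / 2 * (1 / 3) ^ m" if "m \<le> n" for m n
    proof -
      have "l2_norm (\<lambda>t. y n t - y m t) \<le> 3 / 2 * ((1 / 3) ^ m - (1 / 3) ^ n)"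
        using dist[of m "n - m"] that by simp
      also have "\<dots> \<le> 3 / 2 * (1 / 3) ^ m" by simp
      finally show ?thesis .
    qed
    obtain h where h: "h \<in> L2" "(\<lambda>n. l2_norm (\<lambda>t. y n t - h t)) \<longlonglongrightarrow> 0"
    proof (rule L2_complete[OF y])
      fix e :: real assume "e > 0"
      then obtain k where k: "(1 / 3 :: real) ^ k < e / 3"
        using real_arch_pow_inv[of "e / 3" "1 / 3"] by auto
      have "l2_norm (\<lambda>t. y m t - y n t) \<le> e" if "m \<ge> k" "n \<ge> k" for m n
        using l2_norm_triangle_diff[OF y[of m] y[of k] y[of n]] dist'[OF that(1)] dist'[OF that(2)] k
        unfolding l2_norm_minus_commute[of "y k" "y n"] by linarith
      then show "\<exists>M. \<forall>m\<ge>M. \<forall>n\<ge>M. l2_norm (\<lambda>t. y m t - y n t) \<le> e" by blast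
    qed
    have h_close: "l2_norm (\<lambda>t. y m t - h t) \<le> 3 / 2 * (1 / 3) ^ m" for m
    proof (rule LIMSEQ_le_const)
      have "(\<lambda>n. 3 / 2 * (1 / 3) ^ m + l2_norm (\<lambda>t. y n t - h t)) \<longlonglongrightarrow> 3 / 2 * (1 / 3) ^ m + 0"
        by (intro tendsto_intros h)
      then show "(\<lambda>n. 3 / 2 * (1 / 3) ^ m + l2_norm (\<lambda>t. y n t - h t)) \<longlonglongrightarrow> 3 / 2 * (1 / 3) ^ m"
        by simp
      have "l2_norm (\<lambda>t. y m t - h t) \<le> 3 / 2 * (1 / 3) ^ m + l2_norm (\<lambda>t. y n t - h t)" if "n \<ge> m" for n
        using l2_norm_triangle_diff[OF y[of m] y[of n] h(1)] dist'[OF that]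
        unfolding l2_norm_minus_commute[of "y m" "y n"] by linarith
      then show "\<exists>k. \<forall>n\<ge>k. l2_norm (\<lambda>t. y m t - h t) \<le> 3 / 2 * (1 / 3) ^ m + l2_norm (\<lambda>t. y n t - h t)"
        by blast
    qed
    \<comment> \<open>Step \<open>n\<close> brings \<open>q (i n)\<close> to at least \<open>2 / 3 * N (i n) * 3 ^ - n\<close>. The later steps have total
      size at most \<open>3 ^ - n / 2\<close>, so they take away at most \<open>1 / 2 * N (i n) * 3 ^ - n\<close>.\<close>
    have qh: "(4 / 3) ^ n / 6 \<le> q (i n) h" for n
    proof -
      have "q (i n) (y (Suc n)) = q (i n) (\<lambda>t. h t + (y (Suc n) t - h t))"
        by simp
      also have "\<dots> \<le> q (i n) h + q (i n) (\<lambda>t. y (Suc n) t - h t)"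
        using h y by (intro q_add) auto
      also have "q (i n) (\<lambda>t. y (Suc n) t - h t) \<le> N (i n) * l2_norm (\<lambda>t. y (Suc n) t - h t)"
        using h y by (intro q_le_N) auto
      also have "\<dots> \<le> N (i n) * (3 / 2 * (1 / 3) ^ Suc n)"
        using N_pos[of n] by (intro mult_left_mono h_close) auto
      finally have "(1 / 3) ^ n * N (i n) / 6 \<le> q (i n) h"
        using qy[of n] by (simp add: algebra_simps)
      moreover have "(1 / 3) ^ n * 4 ^ n \<le> (1 / 3) ^ n * N (i n)"
        using i[of n] by (intro mult_left_mono) auto
      moreover have "(1 / 3 :: real) ^ n * 4 ^ n = (4 / 3) ^ n"
        by (simp add: power_mult_distrib[symmetric])
      ultimately show ?thesis by simp
    qed
    obtain M where M: "\<forall>i. q i h \<le> M"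
      using pointwise[OF h(1)] by blast
    obtain n where "6 * M < (4 / 3) ^ n"
      using real_arch_pow[of "4 / 3" "6 * M"] by auto
    with qh[of n] M[rule_format, of "i n"] show False by simp
  qed
  then obtain C where C: "\<And>i. N i \<le> C" by blast
  show thesis
  proof
    show "max C 1 > 0" by simp
    show "q i f \<le> max C 1 * l2_norm f" if "f \<in> L2" for i f
    proof -
      have "q i f \<le> N i * l2_norm f" by (rule q_le_N[OF that])
      also have "\<dots> \<le> max C 1 * l2_norm f"
        using C[of i] by (intro mult_right_mono) auto
      finally show ?thesis .
    qed
  qed
qed

section \<open>The trigonometric system on a period interval\<close>

lemma modulation_cis: "modulation c f t = cis (2 * pi * (c * t)) * f t"
proof -
  have "2 * complex_of_real pi * \<i> * complex_of_real c * complex_of_real t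
      = \<i> * complex_of_real (2 * pi * (c * t))"
    by simp
  then show ?thesis
    by (simp only: modulation_def cis_conv_exp)
qed

lemma borel_measurable_cis [measurable (raw)]:
  "f \<in> borel_measurable M \<Longrightarrow> (\<lambda>x. cis (f x)) \<in> borel_measurable M"
  by (rule measurable_compose[OF _ borel_measurable_continuous_onI[OF continuous_on_cis[OF continuous_on_id]]])

text \<open>
  Completeness of the trigonometric system is proved as a uniqueness statement about functions
  with this property. It is stated for integrable functions, because it is then inherited by
  products with trigonometric polynomials.
\<close>

definition trig_orthogonal :: "real \<Rightarrow> (real \<Rightarrow> complex) \<Rightarrow> bool" where
  "trig_orthogonal b h \<longleftrightarrow> integrable lebesgue h \<and>
     (\<forall>m::int. (LINT t|lebesgue. h t * cis (2 * pi * (of_int m * b * t))) = 0)"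

lemma integrable_mult_cis:
  assumes "integrable lebesgue h"
  shows "integrable lebesgue (\<lambda>t. h t * cis (c * t))"
proof (rule Bochner_Integration.integrable_bound[OF assms])
  have "(\<lambda>t. cis (c * t)) \<in> borel_measurable lebesgue"
    by (rule measurable_completion) measurable
  then show "(\<lambda>t. h t * cis (c * t)) \<in> borel_measurable lebesgue"
    using borel_measurable_integrable[OF assms] by (rule borel_measurable_times[rotated])
qed (simp add: norm_mult)

text \<open>
  A real-linear function of \<open>z = cis (2 * pi * b * t)\<close> is a combination of \<open>z\<close> and \<open>cnj z\<close>, and
  multiplication by these only shifts the frequency index by one. The property asserted about \<open>q\<close>
  quantifies over all \<open>h\<close>, so for products of polynomials it can be used twice in a row.
\<close>

lemma trig_orthogonal_mult_polynomial:
  fixes q :: "complex \<Rightarrow> real"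
  assumes "real_polynomial_function q" "trig_orthogonal b h"
  shows "trig_orthogonal b (\<lambda>t. h t * of_real (q (cis (2 * pi * (b * t)))))"
  using assms
proof (induction arbitrary: h rule: real_polynomial_function.induct)
  case (linear f)
  define \<alpha> where "\<alpha> = (of_real (f 1) - \<i> * of_real (f \<i>)) / 2"
  define \<beta> where "\<beta> = (of_real (f 1) + \<i> * of_real (f \<i>)) / 2"
  interpret f: bounded_linear f by fact
  have f: "complex_of_real (f z) = \<alpha> * z + \<beta> * cnj z" for z
  proof -
    have "f (Re z *\<^sub>R 1 + Im z *\<^sub>R \<i>) = Re z * f 1 + Im z * f \<i>"
      unfolding f.add f.scaleR by simp
    moreover have "Re z *\<^sub>R 1 + Im z *\<^sub>R \<i> = z"
      by (simp add: complex_eq_iff)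
    ultimately have "f z = Re z * f 1 + Im z * f \<i>" by simp
    then show ?thesis
      unfolding \<alpha>_def \<beta>_def by (simp add: complex_eq_iff field_simps)
  qed
  have int: "integrable lebesgue h" and
    orth: "\<And>m::int. (LINT t|lebesgue. h t * cis (2 * pi * (of_int m * b * t))) = 0"
    using linear by (auto simp: trig_orthogonal_def)
  have int': "integrable lebesgue (\<lambda>t. h t * cis (2 * pi * (c * t)))" for c
    using integrable_mult_cis[OF int, of "2 * pi * c"] by (simp add: mult.assoc)
  have eq: "h t * of_real (f (cis (2 * pi * (b * t)))) * cis (2 * pi * (of_int m * b * t)) =
       \<alpha> * (h t * cis (2 * pi * (of_int (m + 1) * b * t)))
       + \<beta> * (h t * cis (2 * pi * (of_int (m - 1) * b * t)))" for m t
    by (simp add: f cis_cnj cis_mult algebra_simps)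
  have "(LINT t|lebesgue. h t * of_real (f (cis (2 * pi * (b * t)))) * cis (2 * pi * (of_int m * b * t))) = 0"
    for m :: int
    unfolding eq using int' by (subst Bochner_Integration.integral_add) (auto simp: orth simp del: of_int_add of_int_diff)
  moreover have "integrable lebesgue (\<lambda>t. h t * of_real (f (cis (2 * pi * (b * t)))))"
    using eq[of _ 0] int'[of b] int'[of "- b"] by simp
  ultimately show ?case
    by (simp add: trig_orthogonal_def)
next
  case (const c)
  have "(LINT t|lebesgue. h t * of_real c * cis (2 * pi * (of_int m * b * t)))
      = of_real c * (LINT t|lebesgue. h t * cis (2 * pi * (of_int m * b * t)))" for m :: int
    unfolding integral_mult_right_zero[symmetric] by (simp add: mult_ac)
  then show ?case
    using const by (simp add: trig_orthogonal_def)
next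
  case (add f g)
  have int: "integrable lebesgue (\<lambda>t. u t * cis (2 * pi * (c * t)))" if "trig_orthogonal b u" for u c
    using integrable_mult_cis[of u "2 * pi * c"] that by (simp add: trig_orthogonal_def mult.assoc)
  from add.IH[OF add.prems] show ?case
    using int by (auto simp: trig_orthogonal_def distrib_left distrib_right)
next
  case (mult f g)
  from mult.IH(2)[OF mult.IH(1)[OF mult.prems]] show ?case
    by (simp add: mult.assoc)
qed

text \<open>
  By the Stone-Weierstrass theorem on the unit circle, \<open>\<phi>\<close> is a uniform limit of polynomials.
\<close>

lemma trig_orthogonal_integral_continuous:
  fixes \<phi> :: "complex \<Rightarrow> real"
  assumes h: "trig_orthogonal b h" and \<phi>: "continuous_on (sphere 0 1) \<phi>"
  shows "(LINT t|lebesgue. h t * of_real (\<phi> (cis (2 * pi * (b * t))))) = 0"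
proof -
  let ?c = "\<lambda>t. cis (2 * pi * (b * t))"
  have int: "integrable lebesgue h"
    using h by (simp add: trig_orthogonal_def)
  have "continuous_on UNIV (\<lambda>t. complex_of_real (\<phi> (?c t)))"
    by (intro continuous_intros continuous_on_compose2[OF \<phi>]) auto
  then have "(\<lambda>t. complex_of_real (\<phi> (?c t))) \<in> borel_measurable lebesgue"
    by (intro measurable_completion) (simp add: borel_measurable_continuous_onI)
  then have meas: "(\<lambda>t. h t * of_real (\<phi> (?c t))) \<in> borel_measurable lebesgue"
    using int by (intro borel_measurable_times) auto
  obtain M where M: "\<And>z. z \<in> sphere 0 1 \<Longrightarrow> \<bar>\<phi> z\<bar> \<le> M"
    using compact_continuous_image[OF \<phi>] compact_imp_bounded bounded_iff
    by (metis compact_sphere image_eqI real_norm_def)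
  have "integrable lebesgue (\<lambda>t. of_real M * h t)"
    using int by simp
  then have int\<phi>: "integrable lebesgue (\<lambda>t. h t * of_real (\<phi> (?c t)))"
  proof (rule Bochner_Integration.integrable_bound[OF _ meas])
    show "AE t in lebesgue. cmod (h t * of_real (\<phi> (?c t))) \<le> cmod (of_real M * h t)"
    proof (intro AE_I2)
      fix t
      have "cmod (h t) * \<bar>\<phi> (?c t)\<bar> \<le> cmod (h t) * \<bar>M\<bar>"
        using M[of "?c t"] by (intro mult_left_mono) auto
      then show "cmod (h t * of_real (\<phi> (?c t))) \<le> cmod (of_real M * h t)"
        by (simp add: norm_mult mult.commute)
    qed
  qed
  define I where "I = (LINT t|lebesgue. cmod (h t))"
  have "I \<ge> 0" by (simp add: I_def)
  have "cmod (LINT t|lebesgue. h t * of_real (\<phi> (?c t))) \<le> 0 + e" if "e > 0" for e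
  proof -
    have "e / (I + 1) > 0" using \<open>I \<ge> 0\<close> that by simp
    from Stone_Weierstrass_real_polynomial_function[OF compact_sphere \<phi> this]
    obtain q where q: "real_polynomial_function q"
        "\<And>z. z \<in> sphere 0 1 \<Longrightarrow> \<bar>\<phi> z - q z\<bar> < e / (I + 1)"
      by blast
    have hq: "trig_orthogonal b (\<lambda>t. h t * of_real (q (?c t)))"
      by (rule trig_orthogonal_mult_polynomial[OF q(1) h])
    then have intq: "integrable lebesgue (\<lambda>t. h t * of_real (q (?c t)))"
      and "(LINT t|lebesgue. h t * of_real (q (?c t))) = 0"
      unfolding trig_orthogonal_def by (auto dest: spec[of _ 0])
    then have "(LINT t|lebesgue. h t * of_real (\<phi> (?c t)))
        = (LINT t|lebesgue. h t * of_real (\<phi> (?c t)) - h t * of_real (q (?c t)))"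
      using int\<phi> by simp
    also have "cmod \<dots> \<le> (LINT t|lebesgue. e / (I + 1) * cmod (h t))"
    proof (rule Bochner_Integration.integral_norm_bound_integral)
      show "cmod (h t * of_real (\<phi> (?c t)) - h t * of_real (q (?c t))) \<le> e / (I + 1) * cmod (h t)" for t
      proof -
        have "cmod (h t * of_real (\<phi> (?c t)) - h t * of_real (q (?c t)))
            = cmod (h t) * \<bar>\<phi> (?c t) - q (?c t)\<bar>"
          unfolding right_diff_distrib[symmetric] of_real_diff[symmetric] norm_mult norm_of_real ..
        also have "\<dots> \<le> cmod (h t) * (e / (I + 1))"
          using q(2)[of "?c t"] by (intro mult_left_mono) auto
        finally show ?thesis by (simp add: mult.commute)
      qed
    qed (use int int\<phi> intq in auto)
    also have "\<dots> = e * (I / (I + 1))"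
      by (simp add: I_def)
    also have "\<dots> \<le> e"
      using \<open>I \<ge> 0\<close> that by (intro mult_left_le) auto
    finally show ?thesis by simp
  qed
  then have "cmod (LINT t|lebesgue. h t * of_real (\<phi> (?c t))) \<le> 0"
    by (rule field_le_epsilon)
  then show ?thesis by simp
qed

text \<open>
  The continuous functions \<open>max 0 (1 - n * infdist z C)\<close> decrease to the indicator of \<open>C\<close>.
\<close>

lemma trig_orthogonal_integral_closed:
  assumes h: "trig_orthogonal b h" and C: "closed C" "C \<noteq> {}"
  shows "(LINT t|lebesgue. h t * indicator C (cis (2 * pi * (b * t)))) = 0"
proof -
  let ?c = "\<lambda>t. cis (2 * pi * (b * t))"
  define \<phi> where "\<phi> n z = max 0 (1 - real n * infdist z C)" for n z
  have \<phi>_cont: "continuous_on A (\<phi> n)" for n A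
    unfolding \<phi>_def[abs_def] by (intro continuous_intros)
  have int: "integrable lebesgue h"
    using h by (simp add: trig_orthogonal_def)
  have lim: "(\<lambda>n. \<phi> n z) \<longlonglongrightarrow> indicator C z" for z
  proof (cases "z \<in> C")
    case True
    then show ?thesis by (simp add: \<phi>_def)
  next
    case False
    then have "infdist z C > 0"
      using C by (rule infdist_pos_not_in_closed[rotated 2])
    then obtain N where N: "1 < real N * infdist z C"
      using reals_Archimedean3 by blast
    have "\<phi> n z = 0" if "n \<ge> N" for n
    proof -
      have "real N * infdist z C \<le> real n * infdist z C"
        using that by (intro mult_right_mono infdist_nonneg) auto
      with N show ?thesis by (simp add: \<phi>_def)
    qed
    then have "\<forall>\<^sub>F n in sequentially. \<phi> n z = 0"
      using eventually_sequentially by blast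
    then show ?thesis
      using False tendsto_eventually by fastforce
  qed
  have "(\<lambda>n. LINT t|lebesgue. h t * of_real (\<phi> n (?c t)))
      \<longlonglongrightarrow> (LINT t|lebesgue. h t * of_real (indicator C (?c t)))"
  proof (rule integral_dominated_convergence[where w = "\<lambda>t. cmod (h t)"])
    have "continuous_on UNIV (\<lambda>t. complex_of_real (\<phi> n (?c t)))" for n
      by (intro continuous_intros continuous_on_compose2[OF \<phi>_cont[of UNIV]]) auto
    then have "(\<lambda>t. complex_of_real (\<phi> n (?c t))) \<in> borel_measurable lebesgue" for n
      by (intro measurable_completion) (simp add: borel_measurable_continuous_onI)
    then show "(\<lambda>t. h t * of_real (\<phi> n (?c t))) \<in> borel_measurable lebesgue" for n
      using int by (intro borel_measurable_times) auto
    have "C \<in> sets borel" using C by auto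
    then have "(\<lambda>t. complex_of_real (indicator C (?c t))) \<in> borel_measurable lborel"
      by measurable
    then have "(\<lambda>t. complex_of_real (indicator C (?c t))) \<in> borel_measurable lebesgue"
      by (rule measurable_completion)
    then show "(\<lambda>t. h t * of_real (indicator C (?c t))) \<in> borel_measurable lebesgue"
      using int by (intro borel_measurable_times) auto
    show "AE t in lebesgue. (\<lambda>n. h t * of_real (\<phi> n (?c t))) \<longlonglongrightarrow> h t * of_real (indicator C (?c t))"
      by (intro AE_I2 tendsto_intros lim)
    show "AE t in lebesgue. cmod (h t * of_real (\<phi> n (?c t))) \<le> cmod (h t)" for n
      by (intro AE_I2) (auto simp: norm_mult \<phi>_def intro!: mult_left_le mult_nonneg_nonneg infdist_nonneg)
  qed (use int in auto)
  moreover have "(LINT t|lebesgue. h t * of_real (\<phi> n (?c t))) = 0" for n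
    by (rule trig_orthogonal_integral_continuous[OF h \<phi>_cont])
  ultimately show ?thesis
    by (simp add: LIMSEQ_const_iff of_real_indicator)
qed

lemma cis_inj_on_period:
  assumes "b > 0" "s \<in> {0..<1 / b}" "t \<in> {0..<1 / b}" "cis (2 * pi * (b * s)) = cis (2 * pi * (b * t))"
  shows "s = t"
proof -
  have "sin (2 * pi * (b * s)) = sin (2 * pi * (b * t)) \<and> cos (2 * pi * (b * s)) = cos (2 * pi * (b * t))"
    using assms(4) by (simp add: complex_eq_iff)
  then obtain n :: int where "2 * pi * (b * s) = 2 * pi * (b * t) + 2 * pi * of_int n"
    unfolding sin_cos_eq_iff by blast
  then have "2 * pi * (b * s) = 2 * pi * (b * t + of_int n)"
    by (simp add: algebra_simps)
  then have n: "b * s = b * t + of_int n"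
    by simp
  have "0 \<le> b * s" "b * s < 1" "0 \<le> b * t" "b * t < 1"
    using assms by (auto simp: field_simps)
  with n have "of_int n < (1 :: real)" "of_int n > (- 1 :: real)"
    by linarith+
  then have "n = 0" by simp
  with n assms show ?thesis by simp
qed

lemma sigma_finite_lebesgue: "sigma_finite_measure (lebesgue :: real measure)"
proof
  show "\<exists>A::real set set. countable A \<and> A \<subseteq> sets lebesgue \<and> \<Union>A = space lebesgue \<and>
      (\<forall>a\<in>A. emeasure lebesgue a \<noteq> \<infinity>)"
  proof (intro exI[of _ "range (\<lambda>n::nat. {- real n..real n})"] conjI)
    show "\<Union> (range (\<lambda>n::nat. {- real n..real n})) = space lebesgue"
    proof -
      have "x \<in> (\<Union>n. {- real n..real n})" for x
      proof -
        obtain n where "\<bar>x\<bar> \<le> real n" using real_arch_simple by blast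
        then show ?thesis by (intro UN_I[of n]) auto
      qed
      then show ?thesis by auto
    qed
  qed auto
qed

text \<open>
  The arcs \<open>cis ` {0..2 * pi * b * x}\<close> are closed, so the integral of \<open>h\<close> over every initial
  segment \<open>{..x}\<close> vanishes. These segments determine the integrals of \<open>h\<close> over all measurable sets.
\<close>

lemma trig_orthogonal_AE_zero:
  assumes b: "b > 0" and h: "trig_orthogonal b h"
    and supp: "\<And>t. t \<notin> {0..<1 / b} \<Longrightarrow> h t = 0"
  shows "AE t in lebesgue. h t = 0"
proof -
  let ?c = "\<lambda>t. cis (2 * pi * (b * t))"
  have int: "integrable lebesgue h"
    using h by (simp add: trig_orthogonal_def)
  have set_int: "set_integrable lebesgue A h" if "A \<in> sets lebesgue" for A
    using integrable_mult_indicator[OF that int] by (simp add: set_integrable_def)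
  have total: "(LINT t|lebesgue. h t) = 0"
    using h unfolding trig_orthogonal_def by (auto dest: spec[of _ 0])
  have initial: "(LINT t:{..x}|lebesgue. h t) = 0" for x
  proof -
    consider "x < 0" | "x \<ge> 1 / b" | "0 \<le> x" "x < 1 / b" by linarith
    then show ?thesis
    proof cases
      case 1
      then have "indicator {..x} t *\<^sub>R h t = 0" for t
        using supp[of t] by (auto simp: indicator_def)
      then show ?thesis unfolding set_lebesgue_integral_def by (simp only: integral_zero)
    next
      case 2
      then have "indicator {..x} t *\<^sub>R h t = h t" for t
        using supp[of t] by (auto simp: indicator_def)
      then show ?thesis using total unfolding set_lebesgue_integral_def by (simp only:)
    next
      case 3
      define C where "C = ?c ` {0..x}"
      have "compact C"
        unfolding C_def by (intro compact_continuous_image continuous_intros compact_Icc)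
      moreover have "C \<noteq> {}" using 3 by (simp add: C_def)
      ultimately have "(LINT t|lebesgue. h t * indicator C (?c t)) = 0"
        by (intro trig_orthogonal_integral_closed[OF h] compact_imp_closed)
      moreover have "h t * indicator C (?c t) = indicator {..x} t *\<^sub>R h t" for t
      proof (cases "t \<in> {0..<1 / b}")
        case True
        have "?c t \<in> C \<longleftrightarrow> t \<le> x"
        proof
          assume "?c t \<in> C"
          then obtain s where s: "s \<in> {0..x}" "?c t = ?c s" by (auto simp: C_def)
          then have "t = s" using True 3 by (intro cis_inj_on_period[OF b]) auto
          then show "t \<le> x" using s by simp
        qed (use True in \<open>auto simp: C_def\<close>)
        then show ?thesis by (auto simp: indicator_def)
      qed (simp add: supp)
      ultimately show ?thesis by (simp add: set_lebesgue_integral_def)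
    qed
  qed
  have borel: "(LINT t:A|lebesgue. h t) = 0" if "A \<in> sets borel" for A
    using that
  proof (induction rule: borel_set_induct)
    case empty
    show ?case by (simp add: set_lebesgue_integral_def)
  next
    case (interval x y)
    have "(LINT t:{x..y}|lebesgue. h t) = (LINT t|lebesgue. indicator {..y} t *\<^sub>R h t - indicator {..x} t *\<^sub>R h t)"
      unfolding set_lebesgue_integral_def
    proof (rule integral_cong_AE)
      have "AE t in lebesgue. t \<noteq> x"
        using AE_completion[OF AE_lborel_singleton[of x]] by simp
      then show "AE t in lebesgue. indicator {x..y} t *\<^sub>R h t = indicator {..y} t *\<^sub>R h t - indicator {..x} t *\<^sub>R h t"
        by eventually_elim (use \<open>x \<le> y\<close> in \<open>auto simp: indicator_def\<close>)
    qed (use borel_measurable_integrable[OF set_int[unfolded set_integrable_def]]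
        in \<open>auto intro!: borel_measurable_diff\<close>)
    also have "\<dots> = 0"
      using set_int[of "{..x}"] set_int[of "{..y}"] initial[of x] initial[of y]
      by (simp add: set_integrable_def set_lebesgue_integral_def)
    finally show ?case .
  next
    case (compl A)
    have "(LINT t:-A|lebesgue. h t) = (LINT t|lebesgue. h t - indicator A t *\<^sub>R h t)"
      unfolding set_lebesgue_integral_def
      by (intro Bochner_Integration.integral_cong) (auto simp: indicator_def)
    also have "\<dots> = 0"
      using set_int[of A] compl int total by (simp add: set_integrable_def set_lebesgue_integral_def)
    finally show ?case .
  next
    case (union A)
    have "(LINT t:(\<Union>i. A i)|lebesgue. h t) = (\<Sum>i. (LINT t:(A i)|lebesgue. h t))"
      using union by (intro lebesgue_integral_countable_add set_int)
        (auto simp: disjoint_family_on_def intro!: sets.countable_UN)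
    then show ?case using union by simp
  qed
  show ?thesis
  proof (rule sigma_finite_measure.density_zero[OF sigma_finite_lebesgue int])
    fix A :: "real set" assume "A \<in> sets lebesgue"
    then obtain S N N' where A: "A = S \<union> N" "N \<subseteq> N'" "N' \<in> null_sets lborel" "S \<in> sets lborel"
      by (rule sets_completionE)
    have "AE t in lebesgue. t \<notin> N'"
      using A by (intro AE_completion AE_not_in)
    then have "AE t in lebesgue. indicator A t *\<^sub>R h t = indicator S t *\<^sub>R h t"
      by eventually_elim (use A in \<open>auto simp: indicator_def\<close>)
    then have "(LINT t:A|lebesgue. h t) = (LINT t:S|lebesgue. h t)"
      unfolding set_lebesgue_integral_def using set_int[of A] set_int[of S] \<open>A \<in> sets lebesgue\<close> A
      by (intro integral_cong_AE) (auto simp: set_integrable_def)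
    also have "\<dots> = 0"
      using A by (intro borel) simp
    finally show "(LINT t:A|lebesgue. h t) = 0" .
  qed
qed

definition trig :: "real \<Rightarrow> int \<Rightarrow> real \<Rightarrow> complex" where
  "trig b m t = indicator {0..<1 / b} t * cis (2 * pi * (of_int m * b * t))"

lemma L2_trig [simp]: "trig b m \<in> L2"
proof -
  have "(\<lambda>t. indicator {0..<1 / b} t :: complex) \<in> L2"
  proof -
    have "(cmod (indicator {0..<1 / b} t))\<^sup>2 = indicator {0..<1 / b} t" for t
      by (simp add: indicator_def)
    then show ?thesis
      by (cases "0 < 1 / b") (auto simp: L2_def intro!: borel_measurable_indicator)
  qed
  moreover have "trig b m \<in> borel_measurable lebesgue"
    unfolding trig_def by (rule measurable_completion) measurable
  ultimately show ?thesis
    by (rule L2_bound[where C = 1]) (auto simp: trig_def norm_mult)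
qed

lemma integral_cis_period:
  assumes b: "b > 0"
  shows "(LINT t|lebesgue. indicator {0..<1 / b} t * cis (2 * pi * (of_int m * b * t)))
    = (if m = 0 then of_real (1 / b) else 0)"
proof -
  let ?e = "\<lambda>t. cis (2 * pi * (of_int m * b * t))"
  have "AE t in lborel. t \<noteq> 1 / b" by (rule AE_lborel_singleton)
  then have "(LINT t|lborel. indicator {0..<1 / b} t * ?e t) = (LINT t|lborel. indicator {0..1 / b} t *\<^sub>R ?e t)"
    by (intro integral_cong_AE) (auto elim!: eventually_mono simp: indicator_def)
  also have "\<dots> = (if m = 0 then of_real (1 / b) else 0)"
  proof (cases "m = 0")
    case True
    then show ?thesis using b by (simp add: scaleR_conv_of_real cis_conv_exp)
  next
    case False
    define c where "c = 2 * pi * (of_int m * b)"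
    have c: "c \<noteq> 0" using False b by (simp add: c_def)
    have "((\<lambda>t. cis (c * t) / (\<i> * of_real c)) has_vector_derivative cis (c * t)) (at t within S)" for t S
    proof -
      have "((\<lambda>t. exp (\<i> * of_real c * of_real t) / (\<i> * of_real c)) has_vector_derivative
          exp (\<i> * of_real c * of_real t)) (at t within S)"
        using c by (auto intro!: derivative_eq_intros has_vector_derivative_real_field)
      then show ?thesis by (simp add: cis_conv_exp mult.assoc)
    qed
    then have "(LINT t|lborel. indicator {0..1 / b} t *\<^sub>R cis (c * t))
        = cis (c * (1 / b)) / (\<i> * of_real c) - cis (c * 0) / (\<i> * of_real c)"
      using b by (intro integral_FTC_Icc) (auto intro!: continuous_intros)
    also have "cis (c * (1 / b)) = 1"
      using b cis_multiple_2pi[of "of_int m"] by (simp add: c_def mult.assoc)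
    finally show ?thesis using False by (simp add: c_def mult.assoc)
  qed
  finally show ?thesis
    by (subst integral_completion) auto
qed

lemma l2_inner_trig_trig:
  assumes "b > 0"
  shows "l2_inner (trig b m) (trig b n) = (if m = n then of_real (1 / b) else 0)"
proof -
  have "trig b m t * cnj (trig b n t) = indicator {0..<1 / b} t * cis (2 * pi * (of_int (m - n) * b * t))" for t
    by (simp add: trig_def cis_cnj cis_mult indicator_def algebra_simps)
  then show ?thesis
    unfolding l2_inner_def by (simp only: integral_cis_period[OF assms]) simp
qed

text \<open>
  Bessel's inequality makes the Fourier series of \<open>F\<close> converge to some \<open>h\<close> with the same Fourier
  coefficients. On the period, \<open>F - h\<close> is then orthogonal to all exponentials and vanishes, so the
  series converges to \<open>F\<close>; pairing it with \<open>F\<close> gives the identity.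
\<close>

theorem parseval_period:
  assumes b: "b > 0" and F: "F \<in> L2" and supp: "\<And>t. t \<notin> {0..<1 / b} \<Longrightarrow> F t = 0"
  shows "((\<lambda>m. (cmod (l2_inner F (trig b m)))\<^sup>2) has_sum (l2_norm F)\<^sup>2 / b) UNIV"
proof -
  define c where "c m = l2_inner F (trig b m)" for m
  define u where "u m t = (of_real b * c m) * trig b m t" for m t
  define w where "w m = b * (cmod (c m))\<^sup>2" for m
  have u: "u m \<in> L2" for m
    by (simp add: u_def[abs_def])
  have u_trig: "l2_inner (u m) (trig b n) = (if m = n then c n else 0)" for m n
    using b by (simp add: u_def[abs_def] l2_inner_trig_trig)
  have "l2_inner (u m) (u n) = 0" if "m \<noteq> n" for m n
    using that by (simp add: u_def[abs_def] l2_inner_trig_trig[OF b])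
  moreover have norm_u: "(l2_norm (u m))\<^sup>2 = w m" for m
  proof -
    have "(l2_norm (trig b m))\<^sup>2 = 1 / b"
      using l2_inner_trig_trig[OF b, of m m] unfolding l2_inner_self by (simp only: simp_thms if_True of_real_eq_iff)
    then show ?thesis
      using b by (simp add: u_def[abs_def] w_def power_mult_distrib norm_mult power2_eq_square[of b])
  qed
  ultimately have norm_sum: "(l2_norm (\<lambda>t. \<Sum>m\<in>A. u m t))\<^sup>2 = sum w A" for A
    using l2_norm_sum_orthogonal[of A u] u by simp
  have inner_u: "l2_inner (u m) F = of_real (w m)" for m
  proof -
    have "l2_inner (trig b m) F = cnj (c m)"
      by (simp add: c_def l2_inner_commute[symmetric])
    then show ?thesis
      by (simp add: u_def[abs_def] w_def complex_norm_square del: of_real_power)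
  qed
  have bessel: "sum w A \<le> (l2_norm F)\<^sup>2" for A
  proof -
    have "Re (l2_inner (\<lambda>t. \<Sum>m\<in>A. u m t) F) = sum w A"
      using u F by (simp add: l2_inner_sum_left inner_u)
    then have "(l2_norm (\<lambda>t. (\<Sum>m\<in>A. u m t) - F t))\<^sup>2 = (l2_norm F)\<^sup>2 - sum w A"
      using u F by (subst l2_norm_diff_sq) (auto simp: norm_sum)
    then show ?thesis
      by (metis diff_ge_0_iff_ge zero_le_power2)
  qed
  have w0: "w m \<ge> 0" for m
    using b by (simp add: w_def)
  have "w summable_on UNIV"
    using bessel w0 by (intro nonneg_bdd_above_summable_on bdd_aboveI2) auto
  then obtain h where h: "l2_has_sum u h"
    using l2_has_sum_exists[of u 1 w] u norm_sum by auto
  have h2: "h \<in> L2"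
    using h by (simp add: l2_has_sum_def l2_tendsto_def)
  have inner_h: "l2_inner h (trig b n) = c n" for n
  proof -
    have "((\<lambda>m. l2_inner (u m) (trig b n)) has_sum l2_inner h (trig b n)) UNIV"
      using has_sum_l2_inner[OF u h] by simp
    moreover have "((\<lambda>m. l2_inner (u m) (trig b n)) has_sum c n) UNIV"
      unfolding u_trig by (rule has_sum_finite_neutralI[of "{n}"]) auto
    ultimately show ?thesis by (rule has_sum_unique)
  qed
  define H where "H t = indicator {0..<1 / b} t * (F t - h t)" for t
  have H: "H \<in> L2"
    using F h2 unfolding H_def[abs_def] by (intro L2_indicator L2_diff) auto
  have H_trig: "H t * cis (2 * pi * (of_int m * b * t)) = (F t - h t) * cnj (trig b (- m) t)" for m t
    by (simp add: H_def trig_def cis_cnj indicator_def)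
  have "trig_orthogonal b H"
    unfolding trig_orthogonal_def H_trig
  proof (intro conjI allI)
    have "integrable lebesgue (\<lambda>t. H t * cis (2 * pi * (of_int 0 * b * t)))"
      unfolding H_trig using F h2 by simp
    then show "integrable lebesgue H" by simp
    show "(LINT t|lebesgue. (F t - h t) * cnj (trig b (- m) t)) = 0" for m
      using F h2 inner_h by (simp add: l2_inner_def[symmetric] c_def)
  qed
  then have "AE t in lebesgue. H t = 0"
    by (rule trig_orthogonal_AE_zero[OF b]) (simp add: H_def)
  then have AE: "AE t in lebesgue. F t = indicator {0..<1 / b} t * h t"
    by eventually_elim (use supp in \<open>auto simp: H_def indicator_def split: if_splits\<close>)
  have "((\<lambda>m. l2_inner (u m) F) has_sum l2_inner h F) UNIV"
    by (rule has_sum_l2_inner[OF u h F])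
  also have "l2_inner h F = (LINT t|lebesgue. indicator {0..<1 / b} t * h t * cnj (F t))"
    unfolding l2_inner_def using supp by (intro Bochner_Integration.integral_cong) (auto simp: indicator_def)
  also have "\<dots> = l2_inner F F"
    unfolding l2_inner_def using AE F h2 L2_measurable[OF L2_indicator[OF h2, of "{0..<1 / b}"]] 
    by (intro integral_cong_AE) (auto elim!: eventually_mono intro!: borel_measurable_times dest: L2_measurable)
  finally have "((\<lambda>m. complex_of_real (w m)) has_sum of_real ((l2_norm F)\<^sup>2)) UNIV"
    unfolding inner_u l2_inner_self .
  then have "(w has_sum (l2_norm F)\<^sup>2) UNIV"
    unfolding has_sum_of_real_iff .
  then have "((\<lambda>m. w m * (1 / b)) has_sum (l2_norm F)\<^sup>2 * (1 / b)) UNIV"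
    by (rule has_sum_cmult_left)
  then show ?thesis
    using b by (simp add: w_def c_def)
qed

section \<open>Translations and periodization\<close>

lemma measurable_lebesgue_translate:
  fixes f :: "real \<Rightarrow> complex"
  assumes "f \<in> borel_measurable lebesgue"
  shows "(\<lambda>t. f (t + c)) \<in> borel_measurable lebesgue"
  using borel_measurable_affine[OF assms, of 1 c] by (simp add: add.commute)

lemma lebesgue_integral_translate:
  fixes f :: "real \<Rightarrow> 'a :: euclidean_space"
  shows "(LINT t|lebesgue. f (t + c)) = (LINT t|lebesgue. f t)"
  using lebesgue_integral_real_affine[of 1 f c] by (simp add: add.commute)

lemma integrable_lebesgue_translate:
  fixes f :: "real \<Rightarrow> 'a :: euclidean_space"
  shows "integrable lebesgue f \<Longrightarrow> integrable lebesgue (\<lambda>t. f (t + c))"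
  using lebesgue_integrable_real_affine[of f 1 c] by (simp add: add.commute)

lemma AE_lebesgue_translate:
  fixes P :: "real \<Rightarrow> bool"
  assumes "AE t in lebesgue. P t"
  shows "AE t in lebesgue. P (t + c)"
proof -
  obtain N where N: "N \<in> null_sets lborel" "{t. \<not> P t} \<subseteq> N"
    using assms unfolding AE_completion_iff by (auto elim!: AE_E simp: null_sets_def)
  have "{t. t - (- c) \<in> N} \<in> null_sets lborel"
    by (rule null_sets_translation[OF N(1)])
  then have "AE t in lborel. P (t + c)"
    by (rule AE_I') (use N in auto)
  then show ?thesis by (rule AE_completion)
qed

lemma L2_translate [simp]: "f \<in> L2 \<Longrightarrow> (\<lambda>t. f (t + c)) \<in> L2"
  using integrable_lebesgue_translate[of "\<lambda>t. (cmod (f t))\<^sup>2" c]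
  by (simp add: L2_def measurable_lebesgue_translate)

lemma L2_translate_diff [simp]: "f \<in> L2 \<Longrightarrow> (\<lambda>t. f (t - c)) \<in> L2"
  using L2_translate[of f "- c"] by simp

lemma l2_norm_translate: "l2_norm (\<lambda>t. f (t + c)) = l2_norm f"
  using lebesgue_integral_translate[of "\<lambda>t. (cmod (f t))\<^sup>2" c] by (simp add: l2_norm_def)

text \<open>
  The cells partition the line into translates of a period interval. The index of the cell of
  \<open>t\<close> is \<open>\<lfloor>b * t\<rfloor>\<close>, and support conditions below are expressed through this integer because a
  translation by \<open>l / b\<close> simply adds \<open>l\<close> to it.
\<close>

definition cell :: "real \<Rightarrow> int \<Rightarrow> real set" where
  "cell b l = {of_int l / b..<(of_int l + 1) / b}"

lemma in_cell_iff: "b > 0 \<Longrightarrow> t \<in> cell b l \<longleftrightarrow> \<lfloor>b * t\<rfloor> = l"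
  by (auto simp: cell_def floor_eq_iff field_simps)

lemma cell_0: "cell b 0 = {0..<1 / b}"
  by (simp add: cell_def)

lemma cell_borel [simp]: "cell b l \<in> sets borel"
  by (simp add: cell_def)

lemma floor_shift: "b > 0 \<Longrightarrow> \<lfloor>b * (t + of_int l / b)\<rfloor> = \<lfloor>b * t\<rfloor> + l"
proof -
  assume "b > 0"
  then have "b * (t + of_int l / b) = b * t + of_int l" by (simp add: field_simps)
  then show ?thesis by simp
qed

text \<open>
  The integrals of \<open>\<phi>\<close> against the exponentials with frequencies in \<open>b\<int>\<close> are the Fourier
  coefficients of the periodization \<open>F\<close> of \<open>\<phi>\<close>, so by Parseval their squares add up to
  \<open>\<parallel>F\<parallel>\<^sup>2 / b\<close>. Expanding \<open>\<parallel>F\<parallel>\<^sup>2\<close> over pairs of cells and grouping the pairs by their difference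
  gives the correlations of \<open>\<phi>\<close> with its translates. Two cells that meet the support differ by
  less than \<open>2 * N\<close>, so all \<open>M \<ge> 2 * N\<close> give the same sum.
\<close>

theorem periodization:
  assumes b: "b > 0" and \<phi>: "\<phi> \<in> L2"
    and supp: "\<And>t. \<lfloor>b * t\<rfloor> \<notin> {- int N..<int N} \<Longrightarrow> \<phi> t = 0"
    and N: "2 * N \<le> M"
  obtains E where "E \<ge> 0"
    "of_real E = (\<Sum>k = - int M..int M. l2_inner (\<lambda>t. \<phi> (t - of_int k / b)) \<phi>)"
    "((\<lambda>m::int. (cmod (LINT t|lebesgue. \<phi> t * cnj (cis (2 * pi * (of_int m * b * t)))))\<^sup>2)
       has_sum E / b) UNIV"
proof -
  define J where "J = {- int N..<int N}"
  define K where "K = {- int M..int M}"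
  define \<psi> where "\<psi> l t = indicator (cell b 0) t * \<phi> (t + of_int l / b)" for l t
  define F where "F t = (\<Sum>l\<in>J. \<psi> l t)" for t
  have \<psi>: "\<psi> l \<in> L2" for l
    unfolding \<psi>_def[abs_def] using \<phi> by (intro L2_indicator L2_translate) auto
  have F: "F \<in> L2"
    unfolding F_def[abs_def] using \<psi> by (intro L2_sum) auto
  have F_supp: "F t = 0" if "t \<notin> {0..<1 / b}" for t
    using that by (simp add: F_def \<psi>_def cell_0)
  have cell_shift: "indicator (cell b 0) (t - of_int l / b) = (indicator (cell b l) t :: complex)" for t l
    using floor_shift[OF b, of t "- l"] b by (simp add: indicator_def in_cell_iff)
  have cell_partition: "(\<Sum>l\<in>J. indicator (cell b l) t * \<phi> t) = \<phi> t" for t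
  proof (cases "\<lfloor>b * t\<rfloor> \<in> J")
    case True
    have "(\<Sum>l\<in>J. indicator (cell b l) t * \<phi> t) = (\<Sum>l\<in>J. if l = \<lfloor>b * t\<rfloor> then \<phi> t else 0)"
      using b by (intro sum.cong) (auto simp: in_cell_iff indicator_def)
    then show ?thesis using True by (simp add: J_def)
  next
    case False
    then show ?thesis using supp[of t] by (simp add: J_def)
  qed
  have coeff: "l2_inner F (trig b m) = (LINT t|lebesgue. \<phi> t * cnj (cis (2 * pi * (of_int m * b * t))))"
    for m
  proof -
    define e where "e t = cnj (cis (2 * pi * (of_int m * b * t)))" for t
    have e_period: "e (t - of_int l / b) = e t" for t l
    proof -
      have "2 * pi * (of_int m * b * (t - of_int l / b)) = 2 * pi * (of_int m * b * t) - 2 * pi * of_int (m * l)"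
        using b by (simp add: field_simps)
      then show ?thesis
        using cis_multiple_2pi[of "of_int (m * l)"] by (simp add: e_def cis_divide[symmetric])
    qed
    have "l2_inner F (trig b m) = (\<Sum>l\<in>J. l2_inner (\<psi> l) (trig b m))"
      unfolding F_def[abs_def] using \<psi> by (intro l2_inner_sum_left) auto
    also have "\<dots> = (\<Sum>l\<in>J. LINT t|lebesgue. indicator (cell b l) t * \<phi> t * e t)"
    proof (rule sum.cong)
      fix l
      have "l2_inner (\<psi> l) (trig b m) = (LINT t|lebesgue. indicator (cell b 0) t * \<phi> (t + of_int l / b) * e t)"
        unfolding l2_inner_def by (intro Bochner_Integration.integral_cong)
          (auto simp: \<psi>_def trig_def cell_0 e_def indicator_def)
      also have "\<dots> = (LINT t|lebesgue. indicator (cell b 0) (t + - (of_int l / b)) *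
          \<phi> (t + - (of_int l / b) + of_int l / b) * e (t + - (of_int l / b)))"
        by (rule lebesgue_integral_translate[symmetric])
      also have "\<dots> = (LINT t|lebesgue. indicator (cell b l) t * \<phi> t * e t)"
        by (simp add: cell_shift e_period)
      finally show "l2_inner (\<psi> l) (trig b m) = (LINT t|lebesgue. indicator (cell b l) t * \<phi> t * e t)" .
    qed simp
    also have "\<dots> = (LINT t|lebesgue. (\<Sum>l\<in>J. indicator (cell b l) t * \<phi> t * e t))"
    proof (rule Bochner_Integration.integral_sum[symmetric])
      fix l
      have "integrable lebesgue (\<lambda>t. \<psi> l (t - of_int l / b) * cnj (trig b m (t - of_int l / b)))"
        using \<psi> by (intro integrable_L2_inner L2_translate_diff) auto
      moreover have "\<psi> l (t - of_int l / b) * cnj (trig b m (t - of_int l / b)) =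
          indicator (cell b l) t * \<phi> t * e t" for t
        using e_period[of t l] cell_shift[of t l]
        by (auto simp: \<psi>_def trig_def cell_0[symmetric] e_def indicator_def)
      ultimately show "integrable lebesgue (\<lambda>t. indicator (cell b l) t * \<phi> t * e t)" by simp
    qed
    also have "\<dots> = (LINT t|lebesgue. \<phi> t * e t)"
      by (simp only: sum_distrib_right[symmetric, where r = "e _"] cell_partition)
    finally show ?thesis by (simp add: e_def)
  qed
  define a where "a j k = (LINT t|lebesgue. indicator (cell b j) t * \<phi> (t - of_int k / b) * cnj (\<phi> t))" for j k
  \<comment> \<open>The contribution of the cell \<open>j\<close> to the correlation of \<open>\<phi>\<close> with its translate by \<open>k / b\<close>
    is \<open>a j k\<close>.\<close>
  have \<psi>\<psi>: "l2_inner (\<psi> l) (\<psi> j) = a j (j - l)" for l j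
  proof -
    have "l2_inner (\<psi> l) (\<psi> j) = (LINT t|lebesgue. indicator (cell b 0) t * \<phi> (t + of_int l / b) * cnj (\<phi> (t + of_int j / b)))"
      unfolding l2_inner_def by (intro Bochner_Integration.integral_cong) (auto simp: \<psi>_def indicator_def)
    also have "\<dots> = (LINT t|lebesgue. indicator (cell b 0) (t + - (of_int j / b)) *
          \<phi> (t + - (of_int j / b) + of_int l / b) * cnj (\<phi> (t + - (of_int j / b) + of_int j / b)))"
      by (rule lebesgue_integral_translate[symmetric])
    also have "\<dots> = a j (j - l)"
      unfolding a_def using cell_shift by (simp add: diff_divide_distrib algebra_simps)
    finally show ?thesis .
  qed
  have a_0: "a j k = 0" if "j - k \<notin> J" for j k
  proof -
    have "indicator (cell b j) t * \<phi> (t - of_int k / b) = 0" for t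
    proof (cases "t \<in> cell b j")
      case True
      then have "\<lfloor>b * (t - of_int k / b)\<rfloor> = j - k"
        using floor_shift[OF b, of t "- k"] b by (simp add: in_cell_iff)
      then show ?thesis using supp that by (simp add: J_def)
    qed simp
    then show ?thesis unfolding a_def by (simp only: mult_zero_left integral_zero)
  qed
  have "of_real ((l2_norm F)\<^sup>2) = l2_inner F F"
    by (simp add: l2_inner_self)
  also have "\<dots> = (\<Sum>j\<in>J. \<Sum>l\<in>J. a j (j - l))"
    unfolding F_def[abs_def] using \<psi> by (simp add: l2_inner_sum_left l2_inner_sum_right \<psi>\<psi>)
      (rule sum.swap)
  also have "\<dots> = (\<Sum>j\<in>J. \<Sum>k\<in>K. a j k)"
  proof (rule sum.cong)
    fix j assume j: "j \<in> J"
    have "(\<Sum>l\<in>J. a j (j - l)) = (\<Sum>k\<in>(\<lambda>l. j - l) ` J. a j k)"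
      by (subst sum.reindex) (auto simp: inj_on_def)
    also have "\<dots> = (\<Sum>k\<in>K. a j k)"
    proof (rule sum.mono_neutral_left)
      show "(\<lambda>l. j - l) ` J \<subseteq> K" using j N by (auto simp: J_def K_def)
      show "\<forall>k\<in>K - (\<lambda>l. j - l) ` J. a j k = 0"
      proof
        fix k assume "k \<in> K - (\<lambda>l. j - l) ` J"
        then have "j - k \<notin> J" by (metis DiffD2 diff_diff_eq2 add_diff_cancel_left' image_eqI)
        then show "a j k = 0" by (rule a_0)
      qed
    qed (simp add: K_def)
    finally show "(\<Sum>l\<in>J. a j (j - l)) = (\<Sum>k\<in>K. a j k)" .
  qed simp
  also have "\<dots> = (\<Sum>k\<in>K. \<Sum>j\<in>J. a j k)" by (rule sum.swap)
  also have "\<dots> = (\<Sum>k\<in>K. l2_inner (\<lambda>t. \<phi> (t - of_int k / b)) \<phi>)"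
  proof (rule sum.cong)
    fix k
    have "(\<Sum>j\<in>J. a j k) = (LINT t|lebesgue. (\<Sum>j\<in>J. indicator (cell b j) t * \<phi> (t - of_int k / b) * cnj (\<phi> t)))"
      unfolding a_def using \<phi> by (intro Bochner_Integration.integral_sum[symmetric] integrable_L2_inner L2_indicator) auto
    also have "\<dots> = (LINT t|lebesgue. \<phi> (t - of_int k / b) * cnj (\<Sum>j\<in>J. indicator (cell b j) t * \<phi> t))"
      by (intro Bochner_Integration.integral_cong) (auto simp: sum_distrib_left sum_distrib_right indicator_def intro!: sum.cong)
    finally show "(\<Sum>j\<in>J. a j k) = l2_inner (\<lambda>t. \<phi> (t - of_int k / b)) \<phi>"
      unfolding cell_partition l2_inner_def .
  qed simp
  finally show thesis
    using parseval_period[OF b F F_supp] unfolding coeff K_def by (intro that) auto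
qed

section \<open>Symmetric sums over the integers\<close>

lemma finite_subset_symmetric_interval:
  fixes A :: "int set"
  assumes "finite A"
  shows "\<exists>N. \<forall>n\<ge>N. A \<subseteq> {- int n..int n}"
proof (intro exI allI impI)
  show "A \<subseteq> {- int n..int n}" if n: "n \<ge> nat (Max (insert 0 (abs ` A)))" for n
  proof
    fix x assume "x \<in> A"
    then have "\<bar>x\<bar> \<le> Max (insert 0 (abs ` A))"
      using assms by (intro Max_ge) auto
    then show "x \<in> {- int n..int n}"
      using n by auto
  qed
qed

lemma filterlim_symmetric_interval:
  "filterlim (\<lambda>N. {- int N..int N}) (finite_subsets_at_top UNIV) sequentially"
  unfolding filterlim_finite_subsets_at_top eventually_sequentially
proof (intro allI impI)
  fix X :: "int set" assume "finite X \<and> X \<subseteq> UNIV"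
  then have "finite X" by simp
  from finite_subset_symmetric_interval[OF this] show "\<exists>N. \<forall>n\<ge>N. finite {- int n..int n} \<and> X \<subseteq> {- int n..int n} \<and> {- int n..int n} \<subseteq> UNIV"
    by auto
qed

lemma has_sum_symmetric_limit:
  "(f has_sum S) (UNIV :: int set) \<Longrightarrow> (\<lambda>N. \<Sum>n = - int N..int N. f n) \<longlonglongrightarrow> S"
  unfolding has_sum_def by (rule filterlim_compose[OF _ filterlim_symmetric_interval])

lemma nonneg_has_sum_symmetric:
  fixes f :: "int \<Rightarrow> real"
  assumes f: "\<And>n. f n \<ge> 0" and lim: "(\<lambda>N. \<Sum>n = - int N..int N. f n) \<longlonglongrightarrow> S"
  shows "(f has_sum S) UNIV"
proof -
  have "sum f A \<le> S" if A: "finite A" for A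
  proof -
    have "incseq (\<lambda>N. \<Sum>n = - int N..int N. f n)"
      by (intro incseq_SucI sum_mono2) (auto simp: f)
    then have "(\<Sum>n = - int N..int N. f n) \<le> S" for N
      using lim by (rule incseq_le)
    moreover obtain N where "A \<subseteq> {- int N..int N}"
      using finite_subset_symmetric_interval[OF A] by blast
    then have "sum f A \<le> (\<Sum>n = - int N..int N. f n)"
      by (intro sum_mono2) (auto simp: f)
    ultimately show ?thesis by (rule order_trans[rotated])
  qed
  then have "f summable_on UNIV"
    using f by (intro nonneg_bdd_above_summable_on bdd_aboveI2) auto
  then have "(f has_sum infsum f UNIV) UNIV" by simp
  moreover have "infsum f UNIV = S"
    using has_sum_symmetric_limit[OF calculation] lim by (rule LIMSEQ_unique)
  ultimately show ?thesis by simp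
qed

section \<open>The Walnut terms and the compactly supported Walnut identity\<close>

definition walnut_term ::
    "real \<Rightarrow> real \<Rightarrow> (real \<Rightarrow> complex) \<Rightarrow> int \<Rightarrow> (real \<Rightarrow> complex) \<Rightarrow> real \<Rightarrow> complex" where
  "walnut_term a b g k f t = f (t - of_int k / b) * walnut_G a b g k t"

lemma walnut_partial_eq:
  "walnut_partial a b g K f = (\<lambda>t. \<Sum>k = - int K..int K. walnut_term a b g k f t)"
  by (simp add: walnut_partial_def walnut_term_def translation_def fun_eq_iff)

lemma walnut_partial_add:
  "walnut_partial a b g K (\<lambda>t. f t + h t) = (\<lambda>t. walnut_partial a b g K f t + walnut_partial a b g K h t)"
  by (simp add: walnut_partial_eq walnut_term_def distrib_right sum.distrib)

lemma walnut_partial_diff: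
  "walnut_partial a b g K (\<lambda>t. f t - h t) = (\<lambda>t. walnut_partial a b g K f t - walnut_partial a b g K h t)"
  by (simp add: walnut_partial_eq walnut_term_def left_diff_distrib sum_subtractf)

lemma walnut_partial_cmult:
  "walnut_partial a b g K (\<lambda>t. c * f t) = (\<lambda>t. c * walnut_partial a b g K f t)"
  by (simp add: walnut_partial_eq walnut_term_def sum_distrib_left mult.assoc)

text \<open>
  The bound on \<open>G\<^sub>0\<close> enters through finite partial sums only, so that all estimates stay within
  the real numbers.
\<close>

locale bounded_walnut =
  fixes a b B :: real and g :: "real \<Rightarrow> complex"
  assumes b: "b > 0" and g: "g \<in> L2" and B: "B \<ge> 0"
    and bound: "AE t in lebesgue. \<forall>A. finite A \<longrightarrow> (\<Sum>n\<in>A. (cmod (g (t - of_int n * a)))\<^sup>2) \<le> B"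
begin

definition G_sum :: "int \<Rightarrow> int set \<Rightarrow> real \<Rightarrow> complex" where
  "G_sum k A t = (\<Sum>n\<in>A. g (t - of_int n * a) * cnj (g (t - of_int n * a - of_int k / b)))"

lemma g_measurable: "(\<lambda>t. g (t + c)) \<in> borel_measurable lebesgue"
  using g by (intro measurable_lebesgue_translate L2_measurable)

lemma G_sum_measurable: "G_sum k A \<in> borel_measurable lebesgue"
proof -
  have "(\<lambda>t. g (t - c)) \<in> borel_measurable lebesgue" for c
    using g_measurable[of "- c"] by simp
  moreover have "(\<lambda>t. g (t - c - d)) \<in> borel_measurable lebesgue" for c d
    using g_measurable[of "- c - d"] by (simp only: diff_conv_add_uminus add.assoc)
  ultimately show ?thesis
    unfolding G_sum_def[abs_def] by (intro borel_measurable_sum borel_measurable_times borel_measurable_cnj)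
qed

text \<open>
  By \<open>2 * \<bar>x * y\<bar> \<le> \<bar>x\<bar>\<^sup>2 + \<bar>y\<bar>\<^sup>2\<close>, the series for \<open>G\<^sub>k (t)\<close> is dominated by the mean of those for
  \<open>G\<^sub>0 (t)\<close> and \<open>G\<^sub>0 (t - k/b)\<close>. The bound on the partial sums serves as a dominating function later.
\<close>

lemma walnut_G_AE:
  "AE t in lebesgue. (\<forall>A. finite A \<longrightarrow> cmod (G_sum k A t) \<le> B) \<and> cmod (walnut_G a b g k t) \<le> B
     \<and> (\<lambda>N. G_sum k {- int N..int N} t) \<longlonglongrightarrow> walnut_G a b g k t"
  using bound AE_lebesgue_translate[OF bound, of "- (of_int k / b)"]
proof eventually_elim
  case (elim t)
  define s where "s n = g (t - of_int n * a) * cnj (g (t - of_int n * a - of_int k / b))" for n :: int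
  have abs_le: "(\<Sum>n\<in>A. cmod (s n)) \<le> B" if "finite A" for A
  proof -
    have "2 * cmod (s n) \<le> (cmod (g (t - of_int n * a)))\<^sup>2 + (cmod (g (t + - (of_int k / b) - of_int n * a)))\<^sup>2" for n
      using sum_squares_bound[of "cmod (g (t - of_int n * a))" "cmod (g (t + - (of_int k / b) - of_int n * a))"]
      by (simp add: s_def norm_mult algebra_simps)
    then have "(\<Sum>n\<in>A. 2 * cmod (s n)) \<le> (\<Sum>n\<in>A. (cmod (g (t - of_int n * a)))\<^sup>2)
        + (\<Sum>n\<in>A. (cmod (g (t + - (of_int k / b) - of_int n * a)))\<^sup>2)"
      unfolding sum.distrib[symmetric] by (rule sum_mono)
    also have "\<dots> \<le> B + B"
      using elim that by (intro add_mono) auto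
    finally show ?thesis by (simp add: sum_distrib_left[symmetric])
  qed
  have le: "cmod (sum s A) \<le> B" if "finite A" for A
    using norm_sum[of s A] abs_le[OF that] by linarith
  have "(\<lambda>n. norm (s n)) summable_on UNIV"
    using abs_le by (intro nonneg_bdd_above_summable_on bdd_aboveI2) auto
  then have "s summable_on UNIV"
    by (rule abs_summable_summable)
  then have hs: "(s has_sum walnut_G a b g k t) UNIV"
    unfolding walnut_G_def s_def by simp
  have "cmod (walnut_G a b g k t) \<le> B"
  proof (rule LIMSEQ_le_const2)
    show "(\<lambda>N. cmod (\<Sum>n = - int N..int N. s n)) \<longlonglongrightarrow> cmod (walnut_G a b g k t)"
      by (intro tendsto_norm has_sum_symmetric_limit hs)
    show "\<exists>N. \<forall>n\<ge>N. cmod (\<Sum>n = - int n..int n. s n) \<le> B"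
      using le by simp
  qed
  then show ?case
    using le has_sum_symmetric_limit[OF hs] by (simp add: G_sum_def s_def)
qed

lemma walnut_G_bound: "AE t in lebesgue. cmod (walnut_G a b g k t) \<le> B"
  using walnut_G_AE[of k] by eventually_elim auto

lemma walnut_G_measurable: "walnut_G a b g k \<in> borel_measurable lebesgue"
proof (rule borel_measurable_AE)
  show "(\<lambda>t. lim (\<lambda>N. G_sum k {- int N..int N} t)) \<in> borel_measurable lebesgue"
    using G_sum_measurable by (intro borel_measurable_lim_metric)
  show "AE t in lebesgue. lim (\<lambda>N. G_sum k {- int N..int N} t) = walnut_G a b g k t"
    using walnut_G_AE[of k] by eventually_elim (auto intro: limI)
qed

lemma walnut_term_measurable: "f \<in> L2 \<Longrightarrow> walnut_term a b g k f \<in> borel_measurable lebesgue"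
  unfolding walnut_term_def[abs_def]
  using L2_measurable[OF L2_translate_diff] walnut_G_measurable by (intro borel_measurable_times)

lemma walnut_term_bound: "AE t in lebesgue. cmod (walnut_term a b g k f t) \<le> B * cmod (f (t - of_int k / b))"
  using walnut_G_bound[of k] by eventually_elim (simp add: walnut_term_def norm_mult mult.commute mult_right_mono)

lemma L2_walnut_term [simp]: "f \<in> L2 \<Longrightarrow> walnut_term a b g k f \<in> L2"
  by (rule L2_bound[OF L2_translate_diff walnut_term_measurable walnut_term_bound])

lemma l2_norm_walnut_term: "f \<in> L2 \<Longrightarrow> l2_norm (walnut_term a b g k f) \<le> B * l2_norm f"
  using l2_norm_mono_AE[OF L2_translate_diff[of f "of_int k / b"] walnut_term_measurable B walnut_term_bound]
    l2_norm_translate[of f "- (of_int k / b)"] by simp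

lemma L2_walnut_partial [simp]: "f \<in> L2 \<Longrightarrow> walnut_partial a b g K f \<in> L2"
  unfolding walnut_partial_eq by simp

lemma l2_norm_walnut_partial: "f \<in> L2 \<Longrightarrow> l2_norm (walnut_partial a b g K f) \<le> (2 * real K + 1) * B * l2_norm f"
proof -
  assume f: "f \<in> L2"
  have "l2_norm (walnut_partial a b g K f) \<le> (\<Sum>k = - int K..int K. l2_norm (walnut_term a b g k f))"
    unfolding walnut_partial_eq using f by (intro l2_norm_sum) auto
  also have "\<dots> \<le> (\<Sum>k = - int K..int K. B * l2_norm f)"
    using f by (intro sum_mono l2_norm_walnut_term)
  finally show ?thesis by simp
qed

lemma l2_inner_walnut_term:
  "l2_inner (walnut_term a b g k f) h = (LINT t|lebesgue. cnj (h t) * f (t - of_int k / b) * walnut_G a b g k t)"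
  unfolding l2_inner_def walnut_term_def by (simp add: mult_ac)

lemma l2_inner_walnut_partial:
  assumes "f \<in> L2" "h \<in> L2"
  shows "l2_inner (walnut_partial a b g K f) h
    = (\<Sum>k = - int K..int K. LINT t|lebesgue. cnj (h t) * f (t - of_int k / b) * walnut_G a b g k t)"
  unfolding walnut_partial_eq l2_inner_walnut_term[symmetric] using assms by (intro l2_inner_sum_left) auto

lemma gabor_eq: "gabor a b g (m, n) t = cis (2 * pi * (of_int m * b * t)) * g (t - of_int n * a)"
  by (simp add: gabor_def modulation_cis translation_def)

lemma gabor_measurable: "gabor a b g p \<in> borel_measurable lebesgue"
proof (cases p)
  case (Pair m n)
  have "(\<lambda>t. cis (2 * pi * (of_int m * b * t))) \<in> borel_measurable lebesgue"
    by (rule measurable_completion) measurable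
  then show ?thesis
    unfolding Pair gabor_eq[abs_def] using g_measurable[of "- (of_int n * a)"]
    by (intro borel_measurable_times) auto
qed

lemma L2_gabor [simp]: "gabor a b g p \<in> L2"
proof (cases p)
  case (Pair m n)
  have "(\<lambda>t. g (t - of_int n * a)) \<in> L2"
    using g by simp
  then show ?thesis
    by (rule L2_bound[where C = 1, OF _ gabor_measurable]) (simp add: Pair gabor_eq norm_mult)
qed

text \<open>
  For fixed \<open>n\<close>, the coefficients \<open>\<langle>f, E\<^bsub>mb\<^esub> T\<^bsub>na\<^esub> g\<rangle>\<close> are the integrals of \<open>\<phi> n = f \<cdot> cnj (T\<^bsub>na\<^esub> g)\<close>
  against exponentials, so \<open>periodization\<close> applies; \<open>\<phi> n\<close> is square integrable because \<open>\<bar>g\<bar>\<^sup>2 \<le> G\<^sub>0 \<le> B\<close>.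
  Summing the correlations of \<open>\<phi> n\<close> over \<open>n\<close> under the integral produces \<open>G\<^sub>k\<close>.
\<close>

theorem gabor_energy_compact_support:
  assumes f: "f \<in> L2" and supp: "\<And>t. \<lfloor>b * t\<rfloor> \<notin> {- int N..<int N} \<Longrightarrow> f t = 0"
    and K: "2 * N \<le> K"
  obtains E where "((\<lambda>p. (cmod (l2_inner f (gabor a b g p)))\<^sup>2) has_sum E) UNIV"
    "l2_inner (walnut_partial a b g K f) f = of_real (b * E)"
proof -
  define \<phi> where "\<phi> n t = f t * cnj (g (t - of_int n * a))" for n :: int and t
  have \<phi>: "\<phi> n \<in> L2" for n
  proof (rule L2_bound[OF f])
    have "AE t in lebesgue. (cmod (g (t - of_int n * a)))\<^sup>2 \<le> B"
      using bound
    proof eventually_elim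
      case (elim t)
      then show ?case using elim[rule_format, of "{n}"] by simp
    qed
    then show "AE t in lebesgue. cmod (\<phi> n t) \<le> sqrt B * cmod (f t)"
    proof eventually_elim
      case (elim t)
      then have "cmod (g (t - of_int n * a)) * cmod (f t) \<le> sqrt B * cmod (f t)"
        by (intro mult_right_mono real_le_rsqrt) auto
      then show ?case by (simp add: \<phi>_def norm_mult mult.commute)
    qed
    show "\<phi> n \<in> borel_measurable lebesgue"
      unfolding \<phi>_def[abs_def] using L2_measurable[OF f] g_measurable[of "- (of_int n * a)"]
      by (intro borel_measurable_times borel_measurable_cnj) auto
  qed
  have \<phi>_supp: "\<lfloor>b * t\<rfloor> \<notin> {- int N..<int N} \<Longrightarrow> \<phi> n t = 0" for t n
    using supp by (simp add: \<phi>_def)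
  have coeff: "(LINT t|lebesgue. \<phi> n t * cnj (cis (2 * pi * (of_int m * b * t)))) = l2_inner f (gabor a b g (m, n))" for m n
    by (simp add: l2_inner_def \<phi>_def gabor_eq mult_ac)
  have "\<forall>n. \<exists>E. E \<ge> 0 \<and> of_real E = (\<Sum>k = - int K..int K. l2_inner (\<lambda>t. \<phi> n (t - of_int k / b)) (\<phi> n)) \<and>
      ((\<lambda>m. (cmod (l2_inner f (gabor a b g (m, n))))\<^sup>2) has_sum E / b) UNIV"
    using periodization[OF b \<phi> \<phi>_supp K] unfolding coeff by metis
  then obtain E where E0: "\<And>n. E n \<ge> 0"
    and E: "\<And>n. of_real (E n) = (\<Sum>k = - int K..int K. l2_inner (\<lambda>t. \<phi> n (t - of_int k / b)) (\<phi> n))"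
    and Esum: "\<And>n. ((\<lambda>m. (cmod (l2_inner f (gabor a b g (m, n))))\<^sup>2) has_sum E n / b) UNIV"
    by metis
  \<comment> \<open>Dominated convergence, with \<open>B * \<bar>f (t)\<bar> * \<bar>f (t - k/b)\<bar>\<close> as the dominating function.\<close>
  have "(\<lambda>M. \<Sum>n = - int M..int M. l2_inner (\<lambda>t. \<phi> n (t - of_int k / b)) (\<phi> n))
      \<longlonglongrightarrow> l2_inner (walnut_term a b g k f) f" for k
  proof -
    have "(\<Sum>n = - int M..int M. l2_inner (\<lambda>t. \<phi> n (t - of_int k / b)) (\<phi> n))
        = (LINT t|lebesgue. cnj (f t) * f (t - of_int k / b) * G_sum k {- int M..int M} t)" for M
    proof -
      have "(\<Sum>n = - int M..int M. l2_inner (\<lambda>t. \<phi> n (t - of_int k / b)) (\<phi> n))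
          = (LINT t|lebesgue. (\<Sum>n = - int M..int M. \<phi> n (t - of_int k / b) * cnj (\<phi> n t)))"
        unfolding l2_inner_def using \<phi>
        by (intro Bochner_Integration.integral_sum[symmetric] integrable_L2_inner L2_translate_diff)
      also have "\<dots> = (LINT t|lebesgue. cnj (f t) * f (t - of_int k / b) * G_sum k {- int M..int M} t)"
        by (intro Bochner_Integration.integral_cong)
          (auto simp: \<phi>_def G_sum_def sum_distrib_left algebra_simps intro!: sum.cong)
      finally show ?thesis .
    qed
    moreover have "(\<lambda>M. LINT t|lebesgue. cnj (f t) * f (t - of_int k / b) * G_sum k {- int M..int M} t)
        \<longlonglongrightarrow> (LINT t|lebesgue. cnj (f t) * f (t - of_int k / b) * walnut_G a b g k t)"
    proof (rule integral_dominated_convergence[where w = "\<lambda>t. cmod (cnj (f t) * f (t - of_int k / b)) * B"])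
      have int: "integrable lebesgue (\<lambda>t. cnj (f t) * f (t - of_int k / b))"
        using f by (intro integrable_L2_mult) auto
      then show "integrable lebesgue (\<lambda>t. cmod (cnj (f t) * f (t - of_int k / b)) * B)"
        by (intro integrable_mult_left integrable_norm)
      show "(\<lambda>t. cnj (f t) * f (t - of_int k / b) * walnut_G a b g k t) \<in> borel_measurable lebesgue"
        using int walnut_G_measurable by (intro borel_measurable_times[OF borel_measurable_integrable])
      show "(\<lambda>t. cnj (f t) * f (t - of_int k / b) * G_sum k {- int M..int M} t) \<in> borel_measurable lebesgue" for M
        using int G_sum_measurable by (intro borel_measurable_times[OF borel_measurable_integrable])
      show "AE t in lebesgue. (\<lambda>M. cnj (f t) * f (t - of_int k / b) * G_sum k {- int M..int M} t)
          \<longlonglongrightarrow> cnj (f t) * f (t - of_int k / b) * walnut_G a b g k t"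
        using walnut_G_AE[of k] by eventually_elim (intro tendsto_intros, simp)
      show "AE t in lebesgue. norm (cnj (f t) * f (t - of_int k / b) * G_sum k {- int M..int M} t)
          \<le> cmod (cnj (f t) * f (t - of_int k / b)) * B" for M
        using walnut_G_AE[of k]
      proof eventually_elim
        case (elim t)
        then have "cmod (G_sum k {- int M..int M} t) \<le> B" by simp
        then show ?case
          unfolding norm_mult[of _ "G_sum k {- int M..int M} t"] by (intro mult_left_mono) auto
      qed
    qed
    ultimately show ?thesis by (simp add: l2_inner_walnut_term)
  qed
  then have "(\<lambda>M. \<Sum>k = - int K..int K. \<Sum>n = - int M..int M. l2_inner (\<lambda>t. \<phi> n (t - of_int k / b)) (\<phi> n))
      \<longlonglongrightarrow> (\<Sum>k = - int K..int K. l2_inner (walnut_term a b g k f) f)"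
    by (intro tendsto_sum)
  moreover have "(\<Sum>k = - int K..int K. l2_inner (walnut_term a b g k f) f) = l2_inner (walnut_partial a b g K f) f"
    using f by (simp add: l2_inner_walnut_partial l2_inner_walnut_term)
  moreover have "(\<Sum>k = - int K..int K. \<Sum>n = - int M..int M. l2_inner (\<lambda>t. \<phi> n (t - of_int k / b)) (\<phi> n))
      = of_real (\<Sum>n = - int M..int M. E n)" for M
    unfolding of_real_sum E by (rule sum.swap)
  ultimately have lim: "(\<lambda>M. complex_of_real (\<Sum>n = - int M..int M. E n)) \<longlonglongrightarrow> l2_inner (walnut_partial a b g K f) f"
    by simp
  define L where "L = Re (l2_inner (walnut_partial a b g K f) f)"
  have "(\<lambda>M. Re (complex_of_real (\<Sum>n = - int M..int M. E n))) \<longlonglongrightarrow> L"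
    unfolding L_def by (intro tendsto_Re lim)
  then have "(\<lambda>M. \<Sum>n = - int M..int M. E n) \<longlonglongrightarrow> L" by simp
  then have "(E has_sum L) UNIV" and limL: "(\<lambda>M. complex_of_real (\<Sum>n = - int M..int M. E n)) \<longlonglongrightarrow> of_real L"
    using E0 by (auto intro: nonneg_has_sum_symmetric tendsto_of_real simp del: of_real_sum)
  then have Eb: "((\<lambda>n. E n / b) has_sum L / b) UNIV"
    using has_sum_cmult_left[of E UNIV L "1 / b"] by simp
  let ?h = "\<lambda>(n, m). (cmod (l2_inner f (gabor a b g (m, n))))\<^sup>2"
  have "?h summable_on (SIGMA n:UNIV. UNIV)"
  proof (rule summable_on_SigmaI[where g = "\<lambda>n. E n / b"])
    show "(\<lambda>n. E n / b) summable_on UNIV"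
      using Eb by (rule has_sum_imp_summable)
  qed (use Esum in auto)
  then have "(?h has_sum L / b) (SIGMA n:UNIV. UNIV)"
    by (intro has_sum_SigmaI[OF _ Eb]) (use Esum in auto)
  then have "((\<lambda>(m, n). ?h (n, m)) has_sum L / b) (UNIV \<times> UNIV)"
    by (rule has_sum_swap[THEN iffD1])
  then have "((\<lambda>p. (cmod (l2_inner f (gabor a b g p)))\<^sup>2) has_sum L / b) UNIV"
    by (simp add: case_prod_unfold)
  moreover have "l2_inner (walnut_partial a b g K f) f = of_real (b * (L / b))"
    using LIMSEQ_unique[OF lim limL] b by simp
  ultimately show thesis by (rule that)
qed

end

section \<open>Convergence and uniform boundedness of the Walnut partial sums\<close>

lemma polarization:
  fixes S :: "(real \<Rightarrow> complex) \<Rightarrow> real \<Rightarrow> complex"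
  assumes S_add: "\<And>f h. S (\<lambda>t. f t + h t) = (\<lambda>t. S f t + S h t)"
    and S_cmult: "\<And>c f. S (\<lambda>t. c * f t) = (\<lambda>t. c * S f t)"
    and S_L2: "\<And>f. f \<in> L2 \<Longrightarrow> S f \<in> L2"
    and f: "f \<in> L2" and h: "h \<in> L2"
  shows "4 * l2_inner (S f) h = (\<Sum>c\<in>{1, - 1, \<i>, - \<i>}. c * l2_inner (S (\<lambda>t. f t + c * h t)) (\<lambda>t. f t + c * h t))"
proof -
  have "l2_inner (S (\<lambda>t. f t + c * h t)) (\<lambda>t. f t + c * h t)
      = l2_inner (S f) f + cnj c * l2_inner (S f) h + c * l2_inner (S h) f + c * cnj c * l2_inner (S h) h" for c
    using f h S_L2 by (simp add: S_add S_cmult algebra_simps)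
  then have "(\<Sum>c\<in>{1, - 1, \<i>, - \<i>}. c * l2_inner (S (\<lambda>t. f t + c * h t)) (\<lambda>t. f t + c * h t))
      = (\<Sum>c\<in>{1, - 1, \<i>, - \<i>}. c * (l2_inner (S f) f + cnj c * l2_inner (S f) h
          + c * l2_inner (S h) f + c * cnj c * l2_inner (S h) h))"
    by (simp only:)
  also have "\<dots> = 4 * l2_inner (S f) h"
    by (simp add: complex_eq_iff algebra_simps)
  finally show ?thesis ..
qed

definition truncate :: "real \<Rightarrow> (real \<Rightarrow> complex) \<Rightarrow> nat \<Rightarrow> real \<Rightarrow> complex" where
  "truncate b f N t = (\<Sum>j\<in>{- int N..<int N}. indicator (cell b j) t * f t)"

lemma truncate_eq:
  assumes "b > 0"
  shows "truncate b f N t = (if \<lfloor>b * t\<rfloor> \<in> {- int N..<int N} then f t else 0)"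
proof -
  have "truncate b f N t = (\<Sum>j\<in>{- int N..<int N}. if j = \<lfloor>b * t\<rfloor> then f t else 0)"
    unfolding truncate_def using assms by (intro sum.cong) (auto simp: in_cell_iff indicator_def)
  then show ?thesis by simp
qed

lemma L2_truncate [simp]: "f \<in> L2 \<Longrightarrow> truncate b f N \<in> L2"
  unfolding truncate_def[abs_def] by (intro L2_sum L2_indicator) auto

lemma l2_norm_truncate_le:
  assumes "b > 0" "f \<in> L2"
  shows "l2_norm (truncate b f N) \<le> l2_norm f"
  using l2_norm_mono_AE[of f "truncate b f N" 1] assms L2_measurable[OF L2_truncate[OF assms(2)]]
  by (simp add: truncate_eq)

lemma truncate_tendsto:
  assumes b: "b > 0" and f: "f \<in> L2"
  shows "l2_tendsto (truncate b f) f sequentially"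
proof -
  have "(\<lambda>N. LINT t|lebesgue. (cmod (truncate b f N t - f t))\<^sup>2) \<longlonglongrightarrow> (LINT t::real|lebesgue. 0)"
  proof (rule integral_dominated_convergence[where w = "\<lambda>t. (cmod (f t))\<^sup>2"])
    show "AE t in lebesgue. (\<lambda>N. (cmod (truncate b f N t - f t))\<^sup>2) \<longlonglongrightarrow> 0"
    proof (rule AE_I2)
      fix t
      have "truncate b f N t = f t" if "N \<ge> nat (\<bar>\<lfloor>b * t\<rfloor>\<bar> + 1)" for N
        unfolding truncate_eq[OF b] using that by auto
      then have "\<forall>\<^sub>F N in sequentially. (cmod (truncate b f N t - f t))\<^sup>2 = 0"
        unfolding eventually_sequentially by (metis diff_self norm_zero zero_power2)
      then show "(\<lambda>N. (cmod (truncate b f N t - f t))\<^sup>2) \<longlonglongrightarrow> 0"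
        by (rule tendsto_eventually)
    qed
    show "(\<lambda>t. (cmod (truncate b f N t - f t))\<^sup>2) \<in> borel_measurable lebesgue" for N
      using f by (intro borel_measurable_integrable L2_integrable L2_diff) auto
    show "AE t in lebesgue. norm ((cmod (truncate b f N t - f t))\<^sup>2) \<le> (cmod (f t))\<^sup>2" for N
      by (rule AE_I2) (simp add: truncate_eq[OF b])
  qed (use f in \<open>auto intro: L2_integrable\<close>)
  then have "(\<lambda>N. sqrt (LINT t|lebesgue. (cmod (truncate b f N t - f t))\<^sup>2)) \<longlonglongrightarrow> sqrt 0"
    by (intro tendsto_real_sqrt) simp
  then show ?thesis
    using f by (simp add: l2_tendsto_def l2_norm_def)
qed

context bounded_walnut
begin

text \<open>
  The Walnut terms of a function supported in one cell live in different cells, hence are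
  orthogonal, and the squares of their norms have bounded partial sums.
\<close>

lemma partial_converges_cell:
  assumes C: "\<And>K. l2_norm (walnut_partial a b g K f) \<le> C"
    and f: "f \<in> L2" and supp: "\<And>t. t \<notin> cell b j \<Longrightarrow> f t = 0"
  shows "\<exists>h. l2_tendsto (\<lambda>K. walnut_partial a b g K f) h sequentially"
proof -
  let ?u = "\<lambda>k. walnut_term a b g k f"
  have orth: "l2_inner (?u k) (?u l) = 0" if "k \<noteq> l" for k l
  proof -
    have "?u k t * cnj (?u l t) = 0" for t
    proof -
      have "f (t - of_int k / b) = 0 \<or> f (t - of_int l / b) = 0"
      proof (rule ccontr)
        assume "\<not> ?thesis"
        then have "t - of_int k / b \<in> cell b j" "t - of_int l / b \<in> cell b j"
          using supp by blast+
        then show False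
          using that floor_shift[OF b, of t "- k"] floor_shift[OF b, of t "- l"] b
          by (simp add: in_cell_iff)
      qed
      then show ?thesis by (auto simp: walnut_term_def)
    qed
    then show ?thesis unfolding l2_inner_def by (simp only: integral_zero)
  qed
  have norm_sum: "(l2_norm (\<lambda>t. \<Sum>k\<in>A. ?u k t))\<^sup>2 = (\<Sum>k\<in>A. (l2_norm (?u k))\<^sup>2)" for A
    using f orth by (intro l2_norm_sum_orthogonal) auto
  have "(\<Sum>k\<in>A. (l2_norm (?u k))\<^sup>2) \<le> C\<^sup>2" if A: "finite A" for A
  proof -
    obtain K where "A \<subseteq> {- int K..int K}"
      using finite_subset_symmetric_interval[OF A] by blast
    then have "(\<Sum>k\<in>A. (l2_norm (?u k))\<^sup>2) \<le> (\<Sum>k = - int K..int K. (l2_norm (?u k))\<^sup>2)"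
      by (intro sum_mono2) auto
    also have "\<dots> = (l2_norm (walnut_partial a b g K f))\<^sup>2"
      unfolding walnut_partial_eq norm_sum ..
    also have "\<dots> \<le> C\<^sup>2"
      by (intro power_mono C) simp
    finally show ?thesis .
  qed
  then have "(\<lambda>k. (l2_norm (?u k))\<^sup>2) summable_on UNIV"
    by (intro nonneg_bdd_above_summable_on bdd_aboveI2) auto
  then obtain h where "l2_has_sum ?u h"
    using l2_has_sum_exists[of ?u 1 "\<lambda>k. (l2_norm (?u k))\<^sup>2"] f norm_sum by auto
  then have "l2_tendsto (\<lambda>K t. \<Sum>k = - int K..int K. ?u k t) h sequentially"
    unfolding l2_has_sum_def l2_tendsto_def
    by (auto intro: filterlim_compose[OF _ filterlim_symmetric_interval]
        eventually_compose_filterlim[OF _ filterlim_symmetric_interval])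
  then show ?thesis unfolding walnut_partial_eq by blast
qed

text \<open>
  Finite sums of functions supported in single cells are dense, and for uniformly bounded
  operators strong convergence passes from a dense subspace to the whole space.
\<close>

theorem partial_converges_if_uniformly_bounded:
  assumes C: "\<And>K f. f \<in> L2 \<Longrightarrow> l2_norm (walnut_partial a b g K f) \<le> C * l2_norm f" and C0: "C > 0"
    and f: "f \<in> L2"
  shows "\<exists>h. l2_tendsto (\<lambda>K. walnut_partial a b g K f) h sequentially"
proof -
  let ?conv = "\<lambda>f. \<exists>h. l2_tendsto (\<lambda>K. walnut_partial a b g K f) h sequentially"
  let ?S = "walnut_partial a b g"
  have zero: "?conv (\<lambda>t. 0)"
    using l2_tendsto_const[of "\<lambda>t. 0" sequentially] by (auto simp: walnut_partial_eq walnut_term_def)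
  have conv_add: "?conv (\<lambda>t. f1 t + f2 t)" if "?conv f1" "?conv f2" for f1 f2
    using that l2_tendsto_add unfolding walnut_partial_add by blast
  have conv_sum: "?conv (\<lambda>t. \<Sum>j\<in>A. indicator (cell b j) t * f t)" if "finite A" for A
    using that
  proof (induction A rule: finite_induct)
    case (insert j A)
    have "?conv (\<lambda>t. indicator (cell b j) t * f t)"
    proof (rule partial_converges_cell[where j = j and C = "C * l2_norm (\<lambda>t. indicator (cell b j) t * f t)"])
      show "(\<lambda>t. indicator (cell b j) t * f t) \<in> L2"
        using f by (intro L2_indicator) auto
      then show "l2_norm (?S K (\<lambda>t. indicator (cell b j) t * f t)) \<le> C * l2_norm (\<lambda>t. indicator (cell b j) t * f t)" for K
        by (rule C)
    qed simp
    from conv_add[OF this insert.IH] show ?case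
      by (simp only: sum.insert[OF insert.hyps])
  qed (use zero in simp)
  have conv_trunc: "?conv (truncate b f N)" for N
    unfolding truncate_def[abs_def] by (rule conv_sum) simp
  have dense: "(\<lambda>N. l2_norm (\<lambda>t. truncate b f N t - f t)) \<longlonglongrightarrow> 0"
    using truncate_tendsto[OF b f] by (simp add: l2_tendsto_def)
  obtain h where "h \<in> L2" "(\<lambda>K. l2_norm (\<lambda>t. ?S K f t - h t)) \<longlonglongrightarrow> 0"
  proof (rule L2_complete[of "\<lambda>K. ?S K f"])
    fix e :: real assume e: "e > 0"
    then have "\<forall>\<^sub>F N in sequentially. l2_norm (\<lambda>t. truncate b f N t - f t) < e / (4 * C)"
      using order_tendstoD(2)[OF dense, of "e / (4 * C)"] C0 by simp
    then obtain N where N: "l2_norm (\<lambda>t. truncate b f N t - f t) < e / (4 * C)"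
      using eventually_happens'[OF sequentially_bot] by blast
    define \<phi> where "\<phi> = truncate b f N"
    have \<phi>: "\<phi> \<in> L2" using f by (simp add: \<phi>_def)
    obtain h where h: "h \<in> L2" "(\<lambda>K. l2_norm (\<lambda>t. ?S K \<phi> t - h t)) \<longlonglongrightarrow> 0"
      using conv_trunc[of N] by (auto simp: l2_tendsto_def \<phi>_def)
    have "\<forall>\<^sub>F K in sequentially. l2_norm (\<lambda>t. ?S K \<phi> t - h t) < e / 4"
      using order_tendstoD(2)[OF h(2), of "e / 4"] e by simp
    then obtain M where M: "\<And>K. K \<ge> M \<Longrightarrow> l2_norm (\<lambda>t. ?S K \<phi> t - h t) < e / 4"
      by (auto simp: eventually_sequentially)
    have near: "l2_norm (\<lambda>t. ?S K f t - h t) \<le> e / 2" if "K \<ge> M" for K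
    proof -
      have "l2_norm (\<lambda>t. ?S K f t - ?S K \<phi> t) = l2_norm (?S K (\<lambda>t. f t - \<phi> t))"
        by (simp add: walnut_partial_diff)
      also have "\<dots> \<le> C * l2_norm (\<lambda>t. f t - \<phi> t)"
        using f \<phi> by (intro C) auto
      also have "\<dots> \<le> C * (e / (4 * C))"
        using N C0 by (intro mult_left_mono) (auto simp: \<phi>_def l2_norm_minus_commute[of f])
      also have "\<dots> = e / 4" using C0 by simp
      finally show ?thesis
        using l2_norm_triangle_diff[of "?S K f" "?S K \<phi>" h] f \<phi> h(1) M[OF that] by simp
    qed
    have "l2_norm (\<lambda>t. ?S K f t - ?S L f t) \<le> e" if "K \<ge> M" "L \<ge> M" for K L
      using l2_norm_triangle_diff[of "?S K f" h "?S L f"] f h(1) near[OF that(1)] near[OF that(2)]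
      unfolding l2_norm_minus_commute[of h "?S L f"] by simp
    then show "\<exists>M. \<forall>K\<ge>M. \<forall>L\<ge>M. l2_norm (\<lambda>t. ?S K f t - ?S L f t) \<le> e" by blast
  qed (use f in auto)
  then show ?thesis
    using f by (auto simp: l2_tendsto_def)
qed

lemma uniformly_bounded_if_bounded:
  assumes bdd: "\<And>f. f \<in> L2 \<Longrightarrow> \<exists>M. \<forall>K. l2_norm (walnut_partial a b g K f) \<le> M"
  obtains C where "C > 0" "\<And>K f. f \<in> L2 \<Longrightarrow> l2_norm (walnut_partial a b g K f) \<le> C * l2_norm f"
proof -
  have "\<exists>C. \<forall>f\<in>L2. l2_norm (walnut_partial a b g K f) \<le> C * l2_norm f" for K
    using l2_norm_walnut_partial by blast
  then show thesis
    by (rule L2_uniform_boundedness[of "\<lambda>K f. l2_norm (walnut_partial a b g K f)", rotated 2])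
      (use bdd that in \<open>simp_all add: walnut_partial_add walnut_partial_cmult l2_norm_triangle\<close>)
qed

lemma uniformly_bounded_if_converges:
  assumes conv: "\<And>f. f \<in> L2 \<Longrightarrow> \<exists>h. l2_tendsto (\<lambda>K. walnut_partial a b g K f) h sequentially"
  obtains C where "C > 0" "\<And>K f. f \<in> L2 \<Longrightarrow> l2_norm (walnut_partial a b g K f) \<le> C * l2_norm f"
proof (rule uniformly_bounded_if_bounded)
  fix f assume f: "f \<in> L2"
  then obtain h where h: "h \<in> L2" "(\<lambda>K. l2_norm (\<lambda>t. walnut_partial a b g K f t - h t)) \<longlonglongrightarrow> 0"
    using conv by (auto simp: l2_tendsto_def)
  then obtain M where M: "\<And>K. l2_norm (\<lambda>t. walnut_partial a b g K f t - h t) \<le> M"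
    using convergent_imp_Bseq[OF convergentI[OF h(2)]] unfolding Bseq_def by (auto simp: abs_le_iff)
  have "l2_norm (walnut_partial a b g K f) \<le> M + l2_norm h" for K
    using l2_norm_triangle[of "\<lambda>t. walnut_partial a b g K f t - h t" h] f h(1) M[of K] by simp
  then show "\<exists>M. \<forall>K. l2_norm (walnut_partial a b g K f) \<le> M" by blast
qed (rule that)

text \<open>
  Polarization extends the bound to all pairs \<open>(f, h)\<close>. Uniform boundedness of the functionals
  \<open>h \<mapsto> \<langle>S\<^sub>K f, h\<rangle>\<close>, tested at \<open>h = S\<^sub>K f\<close>, bounds \<open>\<parallel>S\<^sub>K f\<parallel>\<close> for each \<open>f\<close>; a second application
  makes this bound uniform.
\<close>

lemma uniformly_bounded_if_weakly_bounded:
  assumes bdd: "\<And>f. f \<in> L2 \<Longrightarrow> \<exists>M. \<forall>K. cmod (l2_inner (walnut_partial a b g K f) f) \<le> M"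
  obtains C where "C > 0" "\<And>K f. f \<in> L2 \<Longrightarrow> l2_norm (walnut_partial a b g K f) \<le> C * l2_norm f"
proof (rule uniformly_bounded_if_bounded)
  let ?S = "walnut_partial a b g"
  fix f assume f: "f \<in> L2"
  have weak: "\<exists>M. \<forall>K. cmod (l2_inner (?S K f) h) \<le> M" if h: "h \<in> L2" for h
  proof -
    have "\<forall>c. \<exists>M. \<forall>K. cmod (l2_inner (?S K (\<lambda>t. f t + c * h t)) (\<lambda>t. f t + c * h t)) \<le> M"
      using bdd[OF L2_add[OF f L2_cmult[OF h]]] by blast
    then obtain M where M: "\<And>c K. cmod (l2_inner (?S K (\<lambda>t. f t + c * h t)) (\<lambda>t. f t + c * h t)) \<le> M c"
      by metis
    have "cmod (l2_inner (?S K f) h) \<le> (\<Sum>c\<in>{1, - 1, \<i>, - \<i>}. M c)" for K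
    proof -
      have "4 * cmod (l2_inner (?S K f) h) = cmod (4 * l2_inner (?S K f) h)"
        by (simp add: norm_mult)
      also have "4 * l2_inner (?S K f) h
          = (\<Sum>c\<in>{1, - 1, \<i>, - \<i>}. c * l2_inner (?S K (\<lambda>t. f t + c * h t)) (\<lambda>t. f t + c * h t))"
        using f h by (intro polarization walnut_partial_add walnut_partial_cmult L2_walnut_partial)
      also have "cmod \<dots> \<le> (\<Sum>c\<in>{1, - 1, \<i>, - \<i>}. M c)"
      proof (rule sum_norm_le)
        fix c :: complex assume "c \<in> {1, - 1, \<i>, - \<i>}"
        then have "cmod c = 1" by auto
        then show "cmod (c * l2_inner (?S K (\<lambda>t. f t + c * h t)) (\<lambda>t. f t + c * h t)) \<le> M c"
          using M[of K c] by (simp only: norm_mult mult_1)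
      qed
      finally show ?thesis
        using norm_ge_zero[of "l2_inner (?S K f) h"] by linarith
    qed
    then show ?thesis by blast
  qed
  have "\<exists>C. \<forall>h\<in>L2. cmod (l2_inner (?S K f) h) \<le> C * l2_norm h" for K
    using l2_inner_cauchy_schwarz[OF L2_walnut_partial[OF f]] by blast
  then obtain C where C: "C > 0" "\<And>K h. h \<in> L2 \<Longrightarrow> cmod (l2_inner (?S K f) h) \<le> C * l2_norm h"
    by (rule L2_uniform_boundedness[of "\<lambda>K h. cmod (l2_inner (?S K f) h)", rotated 2])
      (use f weak in \<open>simp_all add: norm_mult norm_triangle_ineq\<close>)
  have "l2_norm (?S K f) \<le> C" for K
  proof (cases "l2_norm (?S K f) = 0")
    case False
    then have pos: "l2_norm (?S K f) > 0" by (simp add: less_le)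
    have "(l2_norm (?S K f))\<^sup>2 \<le> C * l2_norm (?S K f)"
      using C(2)[OF L2_walnut_partial[OF f], of K K] by (simp add: l2_inner_self norm_power)
    then show ?thesis using pos by (simp add: power2_eq_square)
  qed (use C in simp)
  then show "\<exists>M. \<forall>K. l2_norm (?S K f) \<le> M" by blast
qed (rule that)

end

section \<open>The Walnut identity on all of \<open>L\<^sup>2\<close>\<close>

context bounded_walnut
begin

lemma inner_truncate_tendsto:
  "f \<in> L2 \<Longrightarrow> h \<in> L2 \<Longrightarrow> (\<lambda>N. l2_inner (truncate b f N) h) \<longlonglongrightarrow> l2_inner f h"
  by (intro tendsto_l2_inner truncate_tendsto b l2_tendsto_const)

lemma gabor_energy_truncate:
  assumes f: "f \<in> L2" and K: "2 * N \<le> K"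
  obtains E where "((\<lambda>p. (cmod (l2_inner (truncate b f N) (gabor a b g p)))\<^sup>2) has_sum E) UNIV"
    "l2_inner (walnut_partial a b g K (truncate b f N)) (truncate b f N) = of_real (b * E)"
  using gabor_energy_compact_support[OF L2_truncate[OF f] _ K, of b] truncate_eq[OF b] by metis

text \<open>
  For truncations of \<open>f\<close> the energy equals \<open>\<langle>S\<^sub>K f, f\<rangle> / b\<close>. A sum over finitely many indices is
  continuous in \<open>f\<close>, so the estimate survives the removal of the truncation.
\<close>

lemma gabor_bessel:
  assumes C: "\<And>K f. f \<in> L2 \<Longrightarrow> l2_norm (walnut_partial a b g K f) \<le> C * l2_norm f" and C0: "C > 0"
    and f: "f \<in> L2" and A: "finite A"
  shows "(\<Sum>p\<in>A. (cmod (l2_inner f (gabor a b g p)))\<^sup>2) \<le> C / b * (l2_norm f)\<^sup>2"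
proof (rule LIMSEQ_le_const2)
  show "(\<lambda>N. \<Sum>p\<in>A. (cmod (l2_inner (truncate b f N) (gabor a b g p)))\<^sup>2)
      \<longlonglongrightarrow> (\<Sum>p\<in>A. (cmod (l2_inner f (gabor a b g p)))\<^sup>2)"
    using f by (intro tendsto_intros inner_truncate_tendsto) auto
  have "(\<Sum>p\<in>A. (cmod (l2_inner (truncate b f N) (gabor a b g p)))\<^sup>2) \<le> C / b * (l2_norm f)\<^sup>2" for N
  proof -
    let ?f = "truncate b f N"
    have fN: "?f \<in> L2" using f by simp
    obtain E where E: "((\<lambda>p. (cmod (l2_inner ?f (gabor a b g p)))\<^sup>2) has_sum E) UNIV"
      "l2_inner (walnut_partial a b g (2 * N) ?f) ?f = of_real (b * E)"
      using gabor_energy_truncate[OF f order_refl] .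
    have "b * E \<le> cmod (l2_inner (walnut_partial a b g (2 * N) ?f) ?f)"
      unfolding E(2) norm_of_real by simp
    also have "\<dots> \<le> (C * l2_norm ?f) * l2_norm ?f"
      using l2_inner_cauchy_schwarz[OF L2_walnut_partial[OF fN] fN] C[OF fN]
      by (meson l2_norm_nonneg mult_right_mono order_trans)
    also have "\<dots> = C * (l2_norm ?f)\<^sup>2" by (simp add: power2_eq_square)
    also have "\<dots> \<le> C * (l2_norm f)\<^sup>2"
      using C0 l2_norm_truncate_le[OF b f] by (intro mult_left_mono power_mono) auto
    finally have "E \<le> C / b * (l2_norm f)\<^sup>2"
      using b by (simp add: field_simps)
    moreover have "(\<Sum>p\<in>A. (cmod (l2_inner ?f (gabor a b g p)))\<^sup>2) \<le> E"
      using A by (intro finite_sum_le_has_sum[OF E(1)]) auto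
    ultimately show ?thesis by simp
  qed
  then show "\<exists>N. \<forall>n\<ge>N. (\<Sum>p\<in>A. (cmod (l2_inner (truncate b f n) (gabor a b g p)))\<^sup>2) \<le> C / b * (l2_norm f)\<^sup>2"
    by blast
qed

lemma gabor_summable_if_bessel:
  assumes bessel: "\<And>f A. f \<in> L2 \<Longrightarrow> finite A \<Longrightarrow>
      (\<Sum>p\<in>A. (cmod (l2_inner f (gabor a b g p)))\<^sup>2) \<le> D * (l2_norm f)\<^sup>2"
    and f: "f \<in> L2"
  shows "(\<lambda>p. (cmod (l2_inner f (gabor a b g p)))\<^sup>2) summable_on UNIV"
  using bessel[OF f] by (intro nonneg_bdd_above_summable_on bdd_aboveI2) auto

text \<open>
  The square root of the energy is the \<open>\<ell>\<^sup>2\<close> norm of the coefficient sequence, which depends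
  linearly on the function; the claim is Minkowski's inequality together with the Bessel bound.
\<close>

lemma gabor_energy_lipschitz:
  assumes bessel: "\<And>f A. f \<in> L2 \<Longrightarrow> finite A \<Longrightarrow>
      (\<Sum>p\<in>A. (cmod (l2_inner f (gabor a b g p)))\<^sup>2) \<le> D * (l2_norm f)\<^sup>2"
    and D: "D \<ge> 0" and f: "f \<in> L2" and h: "h \<in> L2"
    and Ef: "((\<lambda>p. (cmod (l2_inner f (gabor a b g p)))\<^sup>2) has_sum Ef) UNIV"
    and Eh: "((\<lambda>p. (cmod (l2_inner h (gabor a b g p)))\<^sup>2) has_sum Eh) UNIV"
  shows "sqrt Ef \<le> sqrt Eh + sqrt D * l2_norm (\<lambda>t. f t - h t)"
proof -
  define R where "R = sqrt Eh + sqrt D * l2_norm (\<lambda>t. f t - h t)"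
  have "Eh \<ge> 0" using Eh by (rule has_sum_nonneg) simp
  then have R: "R \<ge> 0" using D by (simp add: R_def)
  have "Ef \<le> R\<^sup>2"
  proof (rule has_sum_le_finite_sums[OF Ef])
    fix A :: "(int \<times> int) set" assume A: "finite A"
    define c where "c u p = cmod (l2_inner u (gabor a b g p))" for u p
    have "L2_set (c f) A \<le> L2_set (\<lambda>p. c h p + c (\<lambda>t. f t - h t) p) A"
    proof (rule L2_set_mono)
      show "c f p \<le> c h p + c (\<lambda>t. f t - h t) p" for p
        using norm_triangle_ineq[of "l2_inner h (gabor a b g p)" "l2_inner (\<lambda>t. f t - h t) (gabor a b g p)"] f h
        by (simp add: c_def)
    qed (simp add: c_def)
    also have "\<dots> \<le> L2_set (c h) A + L2_set (c (\<lambda>t. f t - h t)) A"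
      by (rule L2_set_triangle_ineq)
    also have "L2_set (c h) A \<le> sqrt Eh"
      unfolding L2_set_def c_def using A by (intro real_sqrt_le_mono finite_sum_le_has_sum[OF Eh]) auto
    also have "L2_set (c (\<lambda>t. f t - h t)) A \<le> sqrt (D * (l2_norm (\<lambda>t. f t - h t))\<^sup>2)"
      unfolding L2_set_def c_def using A f h by (intro real_sqrt_le_mono bessel) auto
    also have "\<dots> = sqrt D * l2_norm (\<lambda>t. f t - h t)"
      by (simp add: real_sqrt_mult)
    finally have "sqrt (\<Sum>p\<in>A. (c f p)\<^sup>2) \<le> R"
      by (simp add: L2_set_def R_def)
    then show "(\<Sum>p\<in>A. (cmod (l2_inner f (gabor a b g p)))\<^sup>2) \<le> R\<^sup>2"
      unfolding c_def by (rule sqrt_le_D)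
  qed
  then have "sqrt Ef \<le> sqrt (R\<^sup>2)" by (rule real_sqrt_le_mono)
  then show ?thesis using R by (simp add: R_def)
qed

text \<open>
  Both sides are continuous in \<open>f\<close>: the energy by the Bessel bound, and \<open>\<langle>S\<^sub>K f, f\<rangle>\<close> uniformly
  in \<open>K\<close>. They agree on truncations.
\<close>

theorem walnut_identity_if_uniformly_bounded:
  assumes C: "\<And>K f. f \<in> L2 \<Longrightarrow> l2_norm (walnut_partial a b g K f) \<le> C * l2_norm f" and C0: "C > 0"
    and f: "f \<in> L2"
  obtains E where "((\<lambda>p. (cmod (l2_inner f (gabor a b g p)))\<^sup>2) has_sum E) UNIV"
    "(\<lambda>K. l2_inner (walnut_partial a b g K f) f) \<longlonglongrightarrow> of_real (b * E)"
proof -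
  let ?S = "walnut_partial a b g"
  define f' where "f' N = truncate b f N" for N
  have f': "f' N \<in> L2" for N using f by (simp add: f'_def)
  have D0: "C / b \<ge> 0" using C0 b by simp
  note bessel = gabor_bessel[OF C C0]
  obtain h where h: "l2_tendsto (\<lambda>K. ?S K f) h sequentially"
    using partial_converges_if_uniformly_bounded[OF C C0 f] by blast
  define L where "L = l2_inner h f"
  have L: "(\<lambda>K. l2_inner (?S K f) f) \<longlonglongrightarrow> L"
    unfolding L_def by (rule tendsto_l2_inner[OF h l2_tendsto_const[OF f]])
  have "\<forall>N. \<exists>E. ((\<lambda>p. (cmod (l2_inner (f' N) (gabor a b g p)))\<^sup>2) has_sum E) UNIV"
    unfolding f'_def using gabor_energy_truncate[OF f order_refl] by metis
  then obtain E' where E': "\<And>N. ((\<lambda>p. (cmod (l2_inner (f' N) (gabor a b g p)))\<^sup>2) has_sum E' N) UNIV"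
    by metis
  have S_trunc: "l2_inner (?S K (f' N)) (f' N) = of_real (b * E' N)" if "2 * N \<le> K" for K N
    using gabor_energy_truncate[OF f that] E'[of N] unfolding f'_def by (metis has_sum_unique)
  define d where "d N = l2_norm (\<lambda>t. f' N t - f t)" for N
  have d: "d \<longlonglongrightarrow> 0"
    unfolding d_def[abs_def] f'_def using truncate_tendsto[OF b f] by (simp add: l2_tendsto_def)
  have close: "cmod (of_real (b * E' N) - L) \<le> 2 * C * l2_norm f * d N" for N
  proof (rule LIMSEQ_le_const2)
    show "(\<lambda>K. cmod (of_real (b * E' N) - l2_inner (?S K f) f)) \<longlonglongrightarrow> cmod (of_real (b * E' N) - L)"
      by (intro tendsto_intros L)
    have "cmod (of_real (b * E' N) - l2_inner (?S K f) f) \<le> 2 * C * l2_norm f * d N" if K: "2 * N \<le> K" for K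
    proof -
      have eq: "of_real (b * E' N) - l2_inner (?S K f) f
          = l2_inner (?S K (\<lambda>t. f' N t - f t)) (f' N) + l2_inner (?S K f) (\<lambda>t. f' N t - f t)"
        unfolding S_trunc[OF K, symmetric] walnut_partial_diff using f f' by simp
      have "cmod (of_real (b * E' N) - l2_inner (?S K f) f)
          \<le> l2_norm (?S K (\<lambda>t. f' N t - f t)) * l2_norm (f' N) + l2_norm (?S K f) * d N"
        unfolding eq d_def using f f'
        by (intro order_trans[OF norm_triangle_ineq] add_mono l2_inner_cauchy_schwarz) auto
      also have "\<dots> \<le> (C * d N) * l2_norm f + (C * l2_norm f) * d N"
      proof (rule add_mono; rule mult_mono)
        show "l2_norm (?S K (\<lambda>t. f' N t - f t)) \<le> C * d N"
          unfolding d_def by (rule C[OF L2_diff[OF f' f]])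
        show "l2_norm (?S K f) \<le> C * l2_norm f"
          by (rule C[OF f])
        show "l2_norm (f' N) \<le> l2_norm f"
          unfolding f'_def by (rule l2_norm_truncate_le[OF b f])
      qed (use C0 in \<open>auto simp: d_def\<close>)
      finally show ?thesis by (simp add: algebra_simps)
    qed
    then show "\<exists>M. \<forall>K\<ge>M. cmod (of_real (b * E' N) - l2_inner (?S K f) f) \<le> 2 * C * l2_norm f * d N"
      by blast
  qed
  have "(\<lambda>N. 2 * C * l2_norm f * d N) \<longlonglongrightarrow> 2 * C * l2_norm f * 0"
    by (intro tendsto_intros d)
  then have "(\<lambda>N. 2 * C * l2_norm f * d N) \<longlonglongrightarrow> 0"
    by simp
  then have "(\<lambda>N. complex_of_real (b * E' N) - L) \<longlonglongrightarrow> 0"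
    by (rule Lim_null_comparison[OF always_eventually, OF allI, OF close])
  then have E'_L: "(\<lambda>N. complex_of_real (b * E' N)) \<longlonglongrightarrow> L"
    by (simp add: Lim_null[symmetric])
  define E where "E = infsum (\<lambda>p. (cmod (l2_inner f (gabor a b g p)))\<^sup>2) UNIV"
  have E: "((\<lambda>p. (cmod (l2_inner f (gabor a b g p)))\<^sup>2) has_sum E) UNIV"
    unfolding E_def using gabor_summable_if_bessel[OF bessel f] by simp
  have "norm (sqrt (E' N) - sqrt E) \<le> sqrt (C / b) * d N" for N
    using gabor_energy_lipschitz[OF bessel D0 f' f E' E, of N] gabor_energy_lipschitz[OF bessel D0 f f' E E', of N]
    unfolding d_def l2_norm_minus_commute[of f "f' N"] by (simp add: abs_le_iff)
  then have "\<forall>\<^sub>F N in sequentially. norm (sqrt (E' N) - sqrt E) \<le> sqrt (C / b) * d N"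
    by simp
  moreover have "(\<lambda>N. sqrt (C / b) * d N) \<longlonglongrightarrow> 0"
    using tendsto_mult_left[OF d, of "sqrt (C / b)"] by simp
  ultimately have "(\<lambda>N. sqrt (E' N) - sqrt E) \<longlonglongrightarrow> 0"
    by (rule Lim_null_comparison)
  then have "(\<lambda>N. sqrt (E' N)) \<longlonglongrightarrow> sqrt E"
    by (simp add: Lim_null[symmetric])
  then have "(\<lambda>N. (sqrt (E' N))\<^sup>2) \<longlonglongrightarrow> (sqrt E)\<^sup>2"
    by (rule tendsto_power)
  moreover have "E' N \<ge> 0" for N using E' by (rule has_sum_nonneg) simp
  moreover have "E \<ge> 0" using E by (rule has_sum_nonneg) simp
  ultimately have "(\<lambda>N. E' N) \<longlonglongrightarrow> E" by simp
  then have "(\<lambda>N. complex_of_real (b * E' N)) \<longlonglongrightarrow> of_real (b * E)"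
    by (intro tendsto_intros)
  then have "L = of_real (b * E)"
    using E'_L by (rule LIMSEQ_unique[rotated])
  then show thesis using that[OF E] L by simp
qed

text \<open>
  By duality, the Bessel bound for the coefficients is also a bound for finite combinations
  \<open>v\<close> of the \<open>E\<^bsub>mb\<^esub> T\<^bsub>na\<^esub> g\<close>: expand \<open>\<parallel>v\<parallel>\<^sup>2 = \<langle>v, v\<rangle>\<close> in its first argument and use the
  Cauchy-Schwarz inequality for sums.
\<close>

lemma frame_series_converges:
  assumes bessel: "\<And>f A. f \<in> L2 \<Longrightarrow> finite A \<Longrightarrow>
      (\<Sum>p\<in>A. (cmod (l2_inner f (gabor a b g p)))\<^sup>2) \<le> D * (l2_norm f)\<^sup>2"
    and D: "D > 0" and f: "f \<in> L2"
  obtains h where "l2_has_sum (frame_series a b g f) h"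
proof (rule l2_has_sum_exists)
  show u: "frame_series a b g f p \<in> L2" for p
    by (simp add: frame_series_def)
  show "(\<lambda>p. (cmod (l2_inner f (gabor a b g p)))\<^sup>2) summable_on UNIV"
    by (rule gabor_summable_if_bessel[OF bessel f])
  show "(l2_norm (\<lambda>t. \<Sum>p\<in>A. frame_series a b g f p t))\<^sup>2
      \<le> D * (\<Sum>p\<in>A. (cmod (l2_inner f (gabor a b g p)))\<^sup>2)" if A: "finite A" for A
  proof -
    define v where "v t = (\<Sum>p\<in>A. frame_series a b g f p t)" for t
    define c where "c h p = cmod (l2_inner h (gabor a b g p))" for h p
    have v: "v \<in> L2" unfolding v_def[abs_def] using u by simp
    have "(l2_norm v)\<^sup>2 = cmod (l2_inner v v)"
      by (simp add: l2_inner_self norm_power)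
    also have "l2_inner v v = (\<Sum>p\<in>A. l2_inner (frame_series a b g f p) v)"
      using u v unfolding v_def[abs_def] by (intro l2_inner_sum_left) auto
    also have "\<dots> = (\<Sum>p\<in>A. l2_inner f (gabor a b g p) * cnj (l2_inner v (gabor a b g p)))"
      by (intro sum.cong) (auto simp: frame_series_def l2_inner_commute[symmetric])
    also have "cmod \<dots> \<le> (\<Sum>p\<in>A. \<bar>c f p\<bar> * \<bar>c v p\<bar>)"
      by (rule sum_norm_le) (simp add: c_def norm_mult)
    also have "\<dots> \<le> L2_set (c f) A * L2_set (c v) A"
      by (rule L2_set_mult_ineq)
    also have "\<dots> \<le> L2_set (c f) A * sqrt (D * (l2_norm v)\<^sup>2)"
      unfolding L2_set_def c_def using A v
      by (intro mult_left_mono real_sqrt_le_mono bessel) (auto intro: sum_nonneg)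
    finally have le: "(l2_norm v)\<^sup>2 \<le> (L2_set (c f) A * sqrt D) * l2_norm v"
      by (simp add: real_sqrt_mult mult.assoc)
    have "l2_norm v \<le> L2_set (c f) A * sqrt D"
    proof (cases "l2_norm v = 0")
      case False
      then have "l2_norm v > 0" by (simp add: less_le)
      then show ?thesis using le by (simp add: power2_eq_square)
    qed (use D in \<open>simp add: L2_set_nonneg\<close>)
    then have "(l2_norm v)\<^sup>2 \<le> (L2_set (c f) A * sqrt D)\<^sup>2"
      by (intro power_mono) auto
    also have "\<dots> = D * (\<Sum>p\<in>A. (c f p)\<^sup>2)"
      using D by (simp add: power_mult_distrib L2_set_def sum_nonneg)
    finally show ?thesis unfolding v_def c_def .
  qed
qed (use D that in auto)

lemma frame_op_energy:
  assumes f: "f \<in> L2" and ex: "\<exists>h. l2_has_sum (frame_series a b g f) h"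
  obtains E where "((\<lambda>p. (cmod (l2_inner f (gabor a b g p)))\<^sup>2) has_sum E) UNIV"
    "l2_inner (frame_op a b g f) f = of_real E"
proof -
  let ?w = "\<lambda>p. (cmod (l2_inner f (gabor a b g p)))\<^sup>2"
  have "l2_has_sum (frame_series a b g f) (frame_op a b g f)"
    unfolding frame_op_def using ex by (rule someI_ex)
  then have "((\<lambda>p. l2_inner (frame_series a b g f p) f) has_sum l2_inner (frame_op a b g f) f) UNIV"
    using f by (intro has_sum_l2_inner) (auto simp: frame_series_def)
  moreover have "l2_inner (frame_series a b g f p) f = of_real (?w p)" for p
    by (simp add: frame_series_def complex_norm_square l2_inner_commute[of "gabor a b g p"] del: of_real_power)
  ultimately have hs: "((\<lambda>p. complex_of_real (?w p)) has_sum l2_inner (frame_op a b g f) f) UNIV"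
    by simp
  from has_sum_bounded_linear[OF bounded_linear_Re hs]
  have w: "(?w has_sum Re (l2_inner (frame_op a b g f) f)) UNIV" by simp
  then have "((\<lambda>p. complex_of_real (?w p)) has_sum of_real (Re (l2_inner (frame_op a b g f) f))) UNIV"
    by (simp only: has_sum_of_real_iff)
  then have "l2_inner (frame_op a b g f) f = of_real (Re (l2_inner (frame_op a b g f) f))"
    using hs by (rule has_sum_unique[rotated])
  with w show thesis by (rule that)
qed

end

section \<open>The equivalence\<close>

text \<open>
  The maximum is needed because a negative \<open>B\<close> is sent to \<open>0\<close> by \<^const>\<open>ennreal\<close>.
\<close>

lemma bounded_walnut_if_G0_bounded:
  assumes "b > 0" "g \<in> L2" and G0: "AE t in lebesgue. walnut_G0 a g t \<le> ennreal B"
  shows "bounded_walnut a b (max B 0) g"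
proof
  show "AE t in lebesgue. \<forall>A. finite A \<longrightarrow> (\<Sum>n\<in>A. (cmod (g (t - of_int n * a)))\<^sup>2) \<le> max B 0"
    using G0
  proof eventually_elim
    case (elim t)
    show ?case
    proof (intro allI impI)
      fix A :: "int set" assume A: "finite A"
      let ?u = "\<lambda>n::int. ennreal ((cmod (g (t - of_int n * a)))\<^sup>2)"
      have "ennreal (\<Sum>n\<in>A. (cmod (g (t - of_int n * a)))\<^sup>2) = sum ?u A"
        by simp
      also have "\<dots> \<le> walnut_G0 a g t"
        unfolding walnut_G0_def using A
        by (subst nonneg_infsum_complete) (auto intro: SUP_upper)
      also have "\<dots> \<le> ennreal (max B 0)"
        using elim by (rule order_trans) (auto intro: ennreal_leI)
      finally show "(\<Sum>n\<in>A. (cmod (g (t - of_int n * a)))\<^sup>2) \<le> max B 0"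
        by (simp add: ennreal_le_iff)
    qed
  qed
qed (use assms in auto)

theorem theorem5p5:
  fixes a b B :: real and g :: "real \<Rightarrow> complex"
  assumes "a > 0" and "b > 0" and "g \<in> L2"
    and "AE t in lebesgue. walnut_G0 a g t \<le> ennreal B"
  shows
    "((\<forall>f\<in>L2. \<exists>h. l2_tendsto (\<lambda>K. walnut_partial a b g K f) h sequentially)
       \<longleftrightarrow>
      (\<forall>f\<in>L2. (\<exists>h. l2_has_sum (frame_series a b g f) h) \<and>
         (\<lambda>K. 1 / of_real b * l2_inner (walnut_partial a b g K f) f)
           \<longlonglongrightarrow> l2_inner (frame_op a b g f) f))
     \<and>
     ((\<forall>f\<in>L2. \<exists>h. l2_tendsto (\<lambda>K. walnut_partial a b g K f) h sequentially)
       \<longleftrightarrow>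
      (\<forall>f\<in>L2. (\<lambda>p. (cmod (l2_inner f (gabor a b g p)))\<^sup>2) summable_on UNIV \<and>
         (\<lambda>K. 1 / of_real b *
            (\<Sum>k = - int K..int K.
               (LINT t|lebesgue. cnj (f t) * f (t - of_int k / b) * walnut_G a b g k t)))
           \<longlonglongrightarrow> of_real (\<Sum>\<^sub>\<infinity>p. (cmod (l2_inner f (gabor a b g p)))\<^sup>2)))"
    (is "(?conv \<longleftrightarrow> ?weak) \<and> (?conv \<longleftrightarrow> ?identity)")
proof -
  interpret bounded_walnut a b "max B 0" g
    using assms by (intro bounded_walnut_if_G0_bounded)
  let ?S = "walnut_partial a b g"
  let ?w = "\<lambda>f p. (cmod (l2_inner f (gabor a b g p)))\<^sup>2"
  have "?weak" if conv: "?conv"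
  proof
    fix f assume f: "f \<in> L2"
    obtain C where C: "C > 0" "\<And>K f. f \<in> L2 \<Longrightarrow> l2_norm (?S K f) \<le> C * l2_norm f"
      using uniformly_bounded_if_converges conv by blast
    obtain E where E: "(?w f has_sum E) UNIV" "(\<lambda>K. l2_inner (?S K f) f) \<longlonglongrightarrow> of_real (b * E)"
      using walnut_identity_if_uniformly_bounded[OF C(2) C(1) f] .
    have "\<exists>h. l2_has_sum (frame_series a b g f) h"
      using frame_series_converges[OF gabor_bessel[OF C(2) C(1)] _ f] C(1) b by auto
    moreover from frame_op_energy[OF f this] have "l2_inner (frame_op a b g f) f = of_real E"
      using E(1) by (metis has_sum_unique)
    moreover have "(\<lambda>K. 1 / of_real b * l2_inner (?S K f) f) \<longlonglongrightarrow> 1 / of_real b * of_real (b * E)"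
      by (intro tendsto_intros E)
    ultimately show "(\<exists>h. l2_has_sum (frame_series a b g f) h) \<and>
        (\<lambda>K. 1 / of_real b * l2_inner (?S K f) f) \<longlonglongrightarrow> l2_inner (frame_op a b g f) f"
      using b by simp
  qed
  moreover have "?identity" if weak: "?weak"
  proof
    fix f assume f: "f \<in> L2"
    obtain E where E: "(?w f has_sum E) UNIV" "l2_inner (frame_op a b g f) f = of_real E"
      using frame_op_energy[OF f] weak f by blast
    have "(\<lambda>K. 1 / of_real b * l2_inner (?S K f) f) \<longlonglongrightarrow> l2_inner (frame_op a b g f) f"
      using weak f by blast
    then have "(\<lambda>K. 1 / of_real b * l2_inner (?S K f) f) \<longlonglongrightarrow> of_real (infsum (?w f) UNIV)"
      using E(2) infsumI[OF E(1)] by simp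
    then show "?w f summable_on UNIV \<and>
        (\<lambda>K. 1 / of_real b * (\<Sum>k = - int K..int K.
           (LINT t|lebesgue. cnj (f t) * f (t - of_int k / b) * walnut_G a b g k t)))
          \<longlonglongrightarrow> of_real (infsum (?w f) UNIV)"
      using has_sum_imp_summable[OF E(1)] l2_inner_walnut_partial[OF f f] by simp
  qed
  moreover have "?conv" if identity: "?identity"
  proof -
    have bdd: "\<exists>M. \<forall>K. cmod (l2_inner (?S K f) f) \<le> M" if f: "f \<in> L2" for f
    proof -
      have "(\<lambda>K. 1 / of_real b * l2_inner (?S K f) f) \<longlonglongrightarrow> of_real (infsum (?w f) UNIV)"
        using identity f l2_inner_walnut_partial[OF f f] by simp
      then have "Bseq (\<lambda>K. 1 / of_real b * l2_inner (?S K f) f)"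
        by (intro convergent_imp_Bseq convergentI)
      then obtain M where M: "\<And>K. cmod (1 / of_real b * l2_inner (?S K f) f) \<le> M"
        by (rule BseqE) blast
      have "cmod (l2_inner (?S K f) f) \<le> b * M" for K
        using M[of K] b by (simp add: norm_divide field_simps)
      then show ?thesis by blast
    qed
    obtain C where C: "C > 0" "\<And>K f. f \<in> L2 \<Longrightarrow> l2_norm (?S K f) \<le> C * l2_norm f"
      using uniformly_bounded_if_weakly_bounded[OF bdd] by blast
    show ?conv
      using partial_converges_if_uniformly_bounded[OF C(2) C(1)] by blast
  qed
  ultimately show ?thesis by blast
qed

end
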